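(* For all $0<T<\infty$ and all $0\le t\le T$, the zero-coupon bond price $P(t,T)=E^Q\left[e^{-\int_t^T r(s)ds}\,\middle|\,\mathcal{F}_t\right]$ satisfies \[ P(t,T)=\exp\left\{-A(t,T)-C(t,T)r(t)+U(t,T)\right\}, \] where \[ C(t,T):=\frac{1-e^{-b(T-t)}}{b}, \] \[ A(t,T):=\frac{a}{b}\left\{T-t-C(t,T)\right\}-\frac{\sigma^2}{2b^2}\int_0^{T-t}\left\{m(s)+e^{-bs}-1\right\}^2ds-\frac{\sigma^2 q\, m^2(T-t)}{b^2\{(p+2q)^2e^{2qt}-p^2\}}, \] \[ U(t,T):=\frac{\sigma(p+2q)^2e^{qt}m(T-t)}{b\{(p+2q)^2e^{2qt}-p^2\}}\int_0^t\left(e^{qs}-\frac{p}{p+2q}e^{-qs}\right)dZ(s), \] and $m(t):=\int_0^t pe^{-(p+q)s}\left\{1-e^{-b(t-s)}\right\}ds$ for $t\ge 0$.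
   Context: Let $\{W^*(t)\}_{t\ge 0}$ be a one-dimensional standard Brownian motion on a complete probability space $(\Omega,\mathcal{F},Q)$ and let $\{\mathcal{F}_t\}_{t\ge 0}$ be the $Q$-augmentation of the filtration it generates. Let $p,q$ be real numbers with $0<q<\infty$ and $-q<p<\infty$. Define \[ l(\tau)=1-\frac{2qp}{(p+2q)^2e^{2q\tau}-p^2}\quad(\tau\ge 0), \] \[ Z(t)=W^*(t)-\int_0^t\left\{\int_0^s pe^{-(p+q)(s-\tau)}l(\tau)\,dW^*(\tau)\right\}ds\quad(t\ge 0). \] $Z$ is an It\^o process, and integrals with respect to $dZ$ are It\^o integrals. Let $a,b,\sigma\in(0,\infty)$ and let $\{r(t)\}_{t\ge 0}$ (the short rate) be the unique strong solution of $dr(t)=\{a-br(t)\}dt+\sigma\,dZ(t)$, $t\ge 0$, with deterministic initial value $r(0)\in[0,\infty)$. $E^Q$ denotes expectation under $Q$. *)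

theory Defs
  imports "HOL-Probability.Probability"
begin

text \<open>Processes are functions on \<^typ>\<open>real\<close>; only times \<open>t \<ge> 0\<close> are ever referred to.\<close>

definition natural_filtration ::
    "'a measure \<Rightarrow> (real \<Rightarrow> 'a \<Rightarrow> real) \<Rightarrow> real \<Rightarrow> 'a measure" where
  "natural_filtration Q X t =
     sigma (space Q) {X s -` B \<inter> space Q | s B. 0 \<le> s \<and> s \<le> t \<and> B \<in> sets borel}"

text \<open>
  On a complete space \<^term>\<open>null_sets Q\<close> contains all subsets of null events. These measures only
  serve as sub-\<open>\<sigma>\<close>-algebras; the measure they carry is irrelevant.
\<close>

definition augmented_filtration ::
    "'a measure \<Rightarrow> (real \<Rightarrow> 'a \<Rightarrow> real) \<Rightarrow> real \<Rightarrow> 'a measure" where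
  "augmented_filtration Q X t =
     sigma (space Q) (sets (natural_filtration Q X t) \<union> null_sets Q)"

definition standard_brownian_motion :: "'a measure \<Rightarrow> (real \<Rightarrow> 'a \<Rightarrow> real) \<Rightarrow> bool" where
  "standard_brownian_motion Q W \<longleftrightarrow>
     prob_space Q \<and>
     (\<forall>t\<ge>0. W t \<in> borel_measurable Q) \<and>
     (AE \<omega> in Q. W 0 \<omega> = 0) \<and>
     (AE \<omega> in Q. continuous_on {0..} (\<lambda>t. W t \<omega>)) \<and>
     (\<forall>s t. 0 \<le> s \<and> s < t \<longrightarrow>
        prob_space.indep_set Q (sets (natural_filtration Q W s))
          {(\<lambda>\<omega>. W t \<omega> - W s \<omega>) -` B \<inter> space Q | B. B \<in> sets borel} \<and>
        distributed Q lborel (\<lambda>\<omega>. W t \<omega> - W s \<omega>)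
          (\<lambda>x. ennreal (normal_density 0 (sqrt (t - s)) x)))"

definition continuous_adapted ::
    "'a measure \<Rightarrow> (real \<Rightarrow> 'a measure) \<Rightarrow> (real \<Rightarrow> 'a \<Rightarrow> real) \<Rightarrow> bool" where
  "continuous_adapted Q F X \<longleftrightarrow>
     (\<forall>t\<ge>0. X t \<in> borel_measurable (F t)) \<and>
     (AE \<omega> in Q. continuous_on {0..} (\<lambda>t. X t \<omega>))"

text \<open>
  The Ito integral over \<open>[0, t]\<close> of square-integrable progressively measurable integrands, as the
  mean-square limit of the integrals of simple processes
  \<open>\<Sum>i<n. \<xi> i * indicator {ts i<..ts (Suc i)}\<close>.
\<close>

definition simple_integrand :: "'a measure \<Rightarrow> (real \<Rightarrow> 'a measure) \<Rightarrow> real \<Rightarrow>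
    nat \<Rightarrow> (nat \<Rightarrow> real) \<Rightarrow> (nat \<Rightarrow> 'a \<Rightarrow> real) \<Rightarrow> bool" where
  "simple_integrand Q F t n ts \<xi> \<longleftrightarrow>
     ts 0 = 0 \<and> ts n = t \<and> (\<forall>i<n. ts i \<le> ts (Suc i)) \<and>
     (\<forall>i<n. \<xi> i \<in> borel_measurable (F (ts i)) \<and> (\<exists>c. \<forall>\<omega>\<in>space Q. \<bar>\<xi> i \<omega>\<bar> \<le> c))"

definition simple_process ::
    "nat \<Rightarrow> (nat \<Rightarrow> real) \<Rightarrow> (nat \<Rightarrow> 'a \<Rightarrow> real) \<Rightarrow> real \<Rightarrow> 'a \<Rightarrow> real" where
  "simple_process n ts \<xi> s \<omega> = (\<Sum>i<n. \<xi> i \<omega> * indicator {ts i<..ts (Suc i)} s)"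

definition simple_integral :: "(real \<Rightarrow> 'a \<Rightarrow> real) \<Rightarrow>
    nat \<Rightarrow> (nat \<Rightarrow> real) \<Rightarrow> (nat \<Rightarrow> 'a \<Rightarrow> real) \<Rightarrow> 'a \<Rightarrow> real" where
  "simple_integral W n ts \<xi> \<omega> = (\<Sum>i<n. \<xi> i \<omega> * (W (ts (Suc i)) \<omega> - W (ts i) \<omega>))"

definition progressive_upto ::
    "(real \<Rightarrow> 'a measure) \<Rightarrow> real \<Rightarrow> (real \<Rightarrow> 'a \<Rightarrow> real) \<Rightarrow> bool" where
  "progressive_upto F t H \<longleftrightarrow>
     (\<forall>u\<in>{0..t}. (\<lambda>(s, \<omega>). H s \<omega>) \<in> borel_measurable (restrict_space borel {0..u} \<Otimes>\<^sub>M F u))"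

definition has_ito_integral :: "'a measure \<Rightarrow> (real \<Rightarrow> 'a measure) \<Rightarrow> (real \<Rightarrow> 'a \<Rightarrow> real) \<Rightarrow>
    (real \<Rightarrow> 'a \<Rightarrow> real) \<Rightarrow> real \<Rightarrow> ('a \<Rightarrow> real) \<Rightarrow> bool" where
  "has_ito_integral Q F W H t X \<longleftrightarrow>
     progressive_upto F t H \<and>
     (\<integral>\<^sup>+\<omega>. (\<integral>\<^sup>+s\<in>{0..t}. ennreal ((H s \<omega>)\<^sup>2) \<partial>lborel) \<partial>Q) < \<infinity> \<and>
     X \<in> borel_measurable (F t) \<and>
     (\<exists>n ts \<xi>. (\<forall>k. simple_integrand Q F t (n k) (ts k) (\<xi> k)) \<and>
        (\<lambda>k. \<integral>\<^sup>+\<omega>. (\<integral>\<^sup>+s\<in>{0..t}.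
            ennreal ((simple_process (n k) (ts k) (\<xi> k) s \<omega> - H s \<omega>)\<^sup>2) \<partial>lborel) \<partial>Q)
          \<longlonglongrightarrow> 0 \<and>
        (\<lambda>k. \<integral>\<^sup>+\<omega>. ennreal ((simple_integral W (n k) (ts k) (\<xi> k) \<omega> - X \<omega>)\<^sup>2) \<partial>Q)
          \<longlonglongrightarrow> 0)"

text \<open>
  The integral is determined only up to null sets, and the version is chosen separately for each
  integrand and each \<open>t\<close>. Statements about it must therefore hold almost surely for each fixed
  \<open>t\<close>; path properties require a continuous version.
\<close>

definition ito_integral :: "'a measure \<Rightarrow> (real \<Rightarrow> 'a measure) \<Rightarrow> (real \<Rightarrow> 'a \<Rightarrow> real) \<Rightarrow>
    (real \<Rightarrow> 'a \<Rightarrow> real) \<Rightarrow> real \<Rightarrow> 'a \<Rightarrow> real" where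
  "ito_integral Q F W H t = (SOME X. has_ito_integral Q F W H t X)"

text \<open>\<open>\<integral>\<^sub>0\<^sup>t f dX\<close> for an Ito process with \<open>dX = H dW + K dt\<close>.\<close>

definition ito_process_integral :: "'a measure \<Rightarrow> (real \<Rightarrow> 'a measure) \<Rightarrow>
    (real \<Rightarrow> 'a \<Rightarrow> real) \<Rightarrow> (real \<Rightarrow> 'a \<Rightarrow> real) \<Rightarrow> (real \<Rightarrow> 'a \<Rightarrow> real) \<Rightarrow>
    (real \<Rightarrow> 'a \<Rightarrow> real) \<Rightarrow> real \<Rightarrow> 'a \<Rightarrow> real" where
  "ito_process_integral Q F W H K f t \<omega> =
     ito_integral Q F W (\<lambda>s \<omega>'. f s \<omega>' * H s \<omega>') t \<omega> + (LBINT s:{0..t}. f s \<omega> * K s \<omega>)"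

definition memory_l :: "real \<Rightarrow> real \<Rightarrow> real \<Rightarrow> real" where
  "memory_l p q \<tau> = 1 - 2 * q * p / ((p + 2 * q)\<^sup>2 * exp (2 * q * \<tau>) - p\<^sup>2)"

text \<open>
  \<open>Y s\<close> is the inner integral of \<open>Z\<close>. Its integrand depends on \<open>s\<close>, so the outer
  \<open>ds\<close>-integral is meaningful only for a version of \<open>Y\<close> with continuous paths.
\<close>

definition inner_process :: "'a measure \<Rightarrow> (real \<Rightarrow> 'a measure) \<Rightarrow> (real \<Rightarrow> 'a \<Rightarrow> real) \<Rightarrow>
    real \<Rightarrow> real \<Rightarrow> (real \<Rightarrow> 'a \<Rightarrow> real) \<Rightarrow> bool" where
  "inner_process Q F W p q Y \<longleftrightarrow>
     continuous_adapted Q F Y \<and>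
     (\<forall>s\<ge>0. AE \<omega> in Q. Y s \<omega> =
        ito_integral Q F W (\<lambda>\<tau> _. p * exp (- (p + q) * (s - \<tau>)) * memory_l p q \<tau>) s \<omega>)"

text \<open>
  Strong solution of \<open>dr = (a - b r) dt + \<sigma> dZ\<close>, \<open>r 0 = r0\<close>, in integrated form; as \<open>\<sigma>\<close> is
  constant, \<open>\<integral>\<^sub>0\<^sup>t \<sigma> dZ = \<sigma> (Z t - Z 0)\<close>.
\<close>

definition short_rate :: "'a measure \<Rightarrow> (real \<Rightarrow> 'a measure) \<Rightarrow> (real \<Rightarrow> 'a \<Rightarrow> real) \<Rightarrow>
    real \<Rightarrow> real \<Rightarrow> real \<Rightarrow> real \<Rightarrow> (real \<Rightarrow> 'a \<Rightarrow> real) \<Rightarrow> bool" where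
  "short_rate Q F Z a b \<sigma> r0 r \<longleftrightarrow>
     continuous_adapted Q F r \<and>
     (AE \<omega> in Q. \<forall>t\<ge>0.
        r t \<omega> = r0 + (LBINT s:{0..t}. a - b * r s \<omega>) + \<sigma> * (Z t \<omega> - Z 0 \<omega>))"

definition bond_price :: "'a measure \<Rightarrow> (real \<Rightarrow> 'a measure) \<Rightarrow> (real \<Rightarrow> 'a \<Rightarrow> real) \<Rightarrow>
    real \<Rightarrow> real \<Rightarrow> 'a \<Rightarrow> real" where
  "bond_price Q F r t T = real_cond_exp Q (F t) (\<lambda>\<omega>. exp (- (LBINT s:{t..T}. r s \<omega>)))"

definition bond_C :: "real \<Rightarrow> real \<Rightarrow> real \<Rightarrow> real" where
  "bond_C b t T = (1 - exp (- b * (T - t))) / b"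

definition bond_m :: "real \<Rightarrow> real \<Rightarrow> real \<Rightarrow> real \<Rightarrow> real" where
  "bond_m p q b t = (LBINT s:{0..t}. p * exp (- (p + q) * s) * (1 - exp (- b * (t - s))))"

definition bond_A :: "real \<Rightarrow> real \<Rightarrow> real \<Rightarrow> real \<Rightarrow> real \<Rightarrow> real \<Rightarrow> real \<Rightarrow> real" where
  "bond_A p q a b \<sigma> t T =
     a / b * (T - t - bond_C b t T)
     - \<sigma>\<^sup>2 / (2 * b\<^sup>2) * (LBINT s:{0..T - t}. (bond_m p q b s + exp (- b * s) - 1)\<^sup>2)
     - \<sigma>\<^sup>2 * q * (bond_m p q b (T - t))\<^sup>2
         / (b\<^sup>2 * ((p + 2 * q)\<^sup>2 * exp (2 * q * t) - p\<^sup>2))"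

text \<open>The integral is with respect to \<open>dZ = dW - Y dt\<close>.\<close>

definition bond_U :: "'a measure \<Rightarrow> (real \<Rightarrow> 'a measure) \<Rightarrow> (real \<Rightarrow> 'a \<Rightarrow> real) \<Rightarrow>
    (real \<Rightarrow> 'a \<Rightarrow> real) \<Rightarrow> real \<Rightarrow> real \<Rightarrow> real \<Rightarrow> real \<Rightarrow> real \<Rightarrow> real \<Rightarrow> 'a \<Rightarrow> real" where
  "bond_U Q F W Y p q b \<sigma> t T \<omega> =
     \<sigma> * (p + 2 * q)\<^sup>2 * exp (q * t) * bond_m p q b (T - t)
       / (b * ((p + 2 * q)\<^sup>2 * exp (2 * q * t) - p\<^sup>2))
     * ito_process_integral Q F W (\<lambda>_ _. 1) (\<lambda>s \<omega>'. - Y s \<omega>')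
         (\<lambda>s _. exp (q * s) - p / (p + 2 * q) * exp (- q * s)) t \<omega>"

end

theory Submission imports Defs begin

text \<open>
  Every integrand that meets the Brownian motion here is deterministic and continuously
  differentiable. For such an integrand \<open>f\<close> the Ito integral equals, almost surely, the path functional
  \<open>f v * W v - f u * W u - \<integral> f' s * W s ds\<close> (\<open>AE_ito_integral_eq_wiener\<close>). The inner process, \<open>Z\<close> and the short rate
  thereby become explicit functionals of one continuous path, and what a textbook would derive with
  Ito's formula and a stochastic Fubini theorem reduces to ordinary calculus: two expressions are compared by
  cancelling the terms that are as rough as the path and differentiating the rest.

  Two such path identities carry the proof. First, \<open>integral_rate_path\<close>: the inner process \<open>Y\<close>
  solves a linear equation driven by \<open>W\<close>, so that \<open>\<integral> r\<close> over \<open>[t, T]\<close> is affine in \<open>r t\<close> and \<open>Y t\<close> plus the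
  integral over \<open>[t, T]\<close> of a deterministic loading against \<open>W\<close>. Second, \<open>inner_path_from_Z\<close>:
  \<open>Y t\<close> is a deterministic multiple of the integral with respect to \<open>Z\<close> in \<open>bond_U\<close>.

  The last term of the first identity is a Gaussian variable independent of the past, so
  the conditional expectation of its exponential is the exponential of half the integrated squared
  loading (\<open>real_cond_exp_exp_wiener\<close>). Finally \<open>integral_loading_square\<close> evaluates this
  variance and produces the two quadratic terms of \<open>bond_A\<close>.
\<close>

section \<open>Stieltjes integrals against continuous paths\<close>

definition grid :: "real \<Rightarrow> real \<Rightarrow> nat \<Rightarrow> nat \<Rightarrow> real" where
  "grid u v N k = u + (v - u) * real k / real N"

lemma grid_0 [simp]: "grid u v N 0 = u" by (simp add: grid_def)
lemma grid_last [simp]: "N > 0 \<Longrightarrow> grid u v N N = v" by (simp add: grid_def)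
lemma grid_step: "grid u v N (Suc k) - grid u v N k = (v - u) / real N"
  by (simp add: grid_def add_divide_distrib algebra_simps diff_divide_distrib)
lemma grid_mono: "u \<le> v \<Longrightarrow> i \<le> k \<Longrightarrow> grid u v N i \<le> grid u v N k"
  by (auto simp: grid_def intro!: divide_right_mono mult_left_mono)
lemma grid_in: 
  assumes "u \<le> v" "k \<le> N" "N > 0" shows "grid u v N k \<in> {u..v}"
  using grid_mono[OF assms(1), of 0 k N] grid_mono[OF assms(1,2), of N] assms by simp

text \<open>
  The Stieltjes integral of \<open>f\<close> with respect to \<open>w\<close> over \<open>[u, v]\<close>, with the differential moved onto
  \<open>f\<close>. It makes sense for a path \<open>w\<close> of unbounded variation as soon as \<open>f\<close> is \<open>C\<^sup>1\<close>. The derivative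
  is an argument of its own so that explicit formulas for it can be supplied.
\<close>

definition parts_integral ::
    "(real \<Rightarrow> real) \<Rightarrow> (real \<Rightarrow> real) \<Rightarrow> (real \<Rightarrow> real) \<Rightarrow> real \<Rightarrow> real \<Rightarrow> real" where
  "parts_integral f f' w u v = f v * w v - f u * w u - integral {u..v} (\<lambda>s. f' s * w s)"

definition C1_on :: "real \<Rightarrow> real \<Rightarrow> (real \<Rightarrow> real) \<Rightarrow> (real \<Rightarrow> real) \<Rightarrow> bool" where
  "C1_on u v f f' \<longleftrightarrow> (\<forall>s\<in>{u..v}. (f has_real_derivative f' s) (at s within {u..v})) \<and>
     continuous_on {u..v} f'"

lemma C1_on_continuous: "C1_on u v f f' \<Longrightarrow> continuous_on {u..v} f"
  unfolding C1_on_def by (meson DERIV_continuous_on)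

lemma C1_on_subset: "C1_on u v f f' \<Longrightarrow> {x..y} \<subseteq> {u..v} \<Longrightarrow> C1_on x y f f'"
  unfolding C1_on_def by (meson DERIV_subset continuous_on_subset subsetD)

lemma C1_on_cmult: "C1_on u v f f' \<Longrightarrow> C1_on u v (\<lambda>s. k * f s) (\<lambda>s. k * f' s)"
  unfolding C1_on_def by (auto intro!: derivative_eq_intros continuous_intros)

lemma C1_on_square:
  assumes C1: "C1_on u v f f'"
  shows "C1_on u v (\<lambda>s. (f s)\<^sup>2) (\<lambda>s. 2 * f s * f' s)"
  using C1 C1_on_continuous[OF C1] unfolding C1_on_def
  by (auto intro!: derivative_eq_intros continuous_intros)

lemma C1_on_derivative_bounded:
  assumes C1: "C1_on u v f f'"
  obtains B where "B > 0" "\<And>s. s \<in> {u..v} \<Longrightarrow> \<bar>f' s\<bar> \<le> B"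
proof -
  have "compact (f' ` {u..v})" using C1 by (auto simp: C1_on_def intro!: compact_continuous_image)
  then show ?thesis using that by (auto simp: bounded_pos dest!: compact_imp_bounded)
qed

lemma integral_C1_on: 
  assumes "C1_on u v f f'" "u \<le> v"
  shows "integral {u..v} f' = f v - f u"
proof -
  have "(f' has_integral (f v - f u)) {u..v}"
    using assms by (intro fundamental_theorem_of_calculus) 
      (auto simp: C1_on_def has_real_derivative_iff_has_vector_derivative)
  then show ?thesis by (rule integral_unique)
qed

lemma C1_on_lipschitz:
  assumes C1: "C1_on u v f f'"
  obtains B where "B > 0" "\<And>x y. u \<le> x \<Longrightarrow> x \<le> y \<Longrightarrow> y \<le> v \<Longrightarrow> \<bar>f y - f x\<bar> \<le> B * (y - x)"
proof -
  obtain B where B: "B > 0" "\<And>s. s \<in> {u..v} \<Longrightarrow> \<bar>f' s\<bar> \<le> B"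
    using C1_on_derivative_bounded[OF C1] by blast
  have "\<bar>f y - f x\<bar> \<le> B * (y - x)" if xy: "u \<le> x" "x \<le> y" "y \<le> v" for x y
  proof -
    have s: "{x..y} \<subseteq> {u..v}" using xy by auto
    note C = C1_on_subset[OF C1 s]
    have "norm (integral {x..y} f') \<le> B * (y - x)"
      using C s B(2) by (intro integral_bound xy) (auto simp: C1_on_def)
    then show ?thesis using integral_C1_on[OF C xy(2)] by simp
  qed
  with B(1) show ?thesis by (rule that)
qed

lemma parts_integral_cmult:
  "parts_integral (\<lambda>s. k * f s) (\<lambda>s. k * f' s) w u v = k * parts_integral f f' w u v"
  unfolding parts_integral_def mult.assoc integral_mult_right by (simp add: algebra_simps)

lemma parts_integral_combine:
  assumes "x \<le> y" "y \<le> z" "continuous_on {x..z} f'" "continuous_on {x..z} w"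
  shows "parts_integral f f' w x y + parts_integral f f' w y z = parts_integral f f' w x z"
proof -
  have "(\<lambda>s. f' s * w s) integrable_on {x..z}"
    by (intro integrable_continuous_interval continuous_intros assms)
  then have "integral {x..y} (\<lambda>s. f' s * w s) + integral {y..z} (\<lambda>s. f' s * w s)
      = integral {x..z} (\<lambda>s. f' s * w s)"
    using assms by (intro Henstock_Kurzweil_Integration.integral_combine) auto
  then show ?thesis by (simp add: parts_integral_def)
qed

text \<open>
  On one step the Riemann term and the Stieltjes integral differ by
  \<open>\<integral> f' s * (w s - w y) ds\<close>, which is controlled by the oscillation of \<open>w\<close> alone.
\<close>

lemma riemann_step_error:
  assumes C1: "C1_on x y f f'" and xy: "x \<le> y" and w: "continuous_on {x..y} w"
    and B: "\<And>s. s \<in> {x..y} \<Longrightarrow> \<bar>f' s\<bar> \<le> B" and e: "\<And>s. s \<in> {x..y} \<Longrightarrow> \<bar>w s - w y\<bar> \<le> e"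
  shows "\<bar>f x * (w y - w x) - parts_integral f f' w x y\<bar> \<le> B * e * (y - x)"
proof -
  have c: "continuous_on {x..y} f'" using C1 by (simp add: C1_on_def)
  have i1: "(\<lambda>s. f' s * w s) integrable_on {x..y}"
    by (intro integrable_continuous_interval continuous_intros c w)
  have i2: "(\<lambda>s. f' s * w y) integrable_on {x..y}"
    by (intro integrable_continuous_interval continuous_intros c w)
  have "integral {x..y} (\<lambda>s. f' s * (w s - w y)) = 
      integral {x..y} (\<lambda>s. f' s * w s) - integral {x..y} f' * w y"
    using Henstock_Kurzweil_Integration.integral_diff[OF i1 i2] by (simp add: algebra_simps)
  also have "\<dots> = f x * (w y - w x) - parts_integral f f' w x y"
    by (simp add: parts_integral_def integral_C1_on[OF C1 xy] algebra_simps)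
  finally have eq: "f x * (w y - w x) - parts_integral f f' w x y =
      integral {x..y} (\<lambda>s. f' s * (w s - w y))" by simp
  have B0: "B \<ge> 0" using B[of x] xy by (auto intro: order_trans[OF abs_ge_zero])
  have "norm (integral {x..y} (\<lambda>s. f' s * (w s - w y))) \<le> (B * e) * (y - x)"
    by (rule integral_bound[OF xy])
      (auto intro!: continuous_intros c w mult_mono B e simp: abs_mult B0)
  then show ?thesis using eq by simp
qed

lemma riemann_sum_error:
  assumes C1: "C1_on u v f f'" and uv: "u \<le> v" and w: "continuous_on {u..v} w" and N: "N > 0"
    and B: "\<And>s. s \<in> {u..v} \<Longrightarrow> \<bar>f' s\<bar> \<le> B"
    and e: "\<And>s s'. s \<in> {u..v} \<Longrightarrow> s' \<in> {u..v} \<Longrightarrow> \<bar>s - s'\<bar> \<le> (v - u) / real N \<Longrightarrow> \<bar>w s - w s'\<bar> \<le> e"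
    and k: "k \<le> N"
  shows "\<bar>(\<Sum>j<k. f (grid u v N j) * (w (grid u v N (Suc j)) - w (grid u v N j)))
      - parts_integral f f' w u (grid u v N k)\<bar> \<le> B * e * (grid u v N k - u)"
  using k
proof (induction k)
  case 0 show ?case by (simp add: parts_integral_def)
next
  case (Suc k)
  let ?x = "grid u v N k" and ?y = "grid u v N (Suc k)"
  have xy: "?x \<le> ?y" by (rule grid_mono[OF uv]) simp
  have xin: "?x \<in> {u..v}" and yin: "?y \<in> {u..v}" 
    using Suc.prems N grid_in[OF uv, of k N] grid_in[OF uv, of "Suc k" N] by auto
  have sub: "{?x..?y} \<subseteq> {u..v}" using xin yin by auto
  have "\<bar>f ?x * (w ?y - w ?x) - parts_integral f f' w ?x ?y\<bar> \<le> B * e * (?y - ?x)"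
  proof (rule riemann_step_error[OF C1_on_subset[OF C1 sub] xy continuous_on_subset[OF w sub]])
    show "\<bar>f' s\<bar> \<le> B" if "s \<in> {?x..?y}" for s using B sub that by blast
    show "\<bar>w s - w ?y\<bar> \<le> e" if s: "s \<in> {?x..?y}" for s
    proof (rule e)
      show "\<bar>s - ?y\<bar> \<le> (v - u) / real N" using s grid_step[of u v N k] by auto
    qed (use s sub yin in auto)
  qed
  moreover have "parts_integral f f' w u ?x + parts_integral f f' w ?x ?y = parts_integral f f' w u ?y"
  proof (rule parts_integral_combine)
    have "{u..?y} \<subseteq> {u..v}" using yin by auto
    then show "continuous_on {u..?y} f'" "continuous_on {u..?y} w"
      using C1 w by (auto simp: C1_on_def intro: continuous_on_subset)
  qed (use xin xy in auto)
  ultimately show ?case using Suc.IH Suc.prems by (simp add: algebra_simps abs_le_iff)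
qed

text \<open>
  This is what turns integrals against Brownian motion into path functionals: the left-endpoint sums
  of a \<open>C\<^sup>1\<close> integrand converge along every continuous path, not just in mean square.
\<close>

lemma riemann_sums_tendsto_parts_integral:
  assumes C1: "C1_on u v f f'" and uv: "u \<le> v" and w: "continuous_on {u..v} w"
  shows "(\<lambda>n. \<Sum>k<Suc n. f (grid u v (Suc n) k) *
            (w (grid u v (Suc n) (Suc k)) - w (grid u v (Suc n) k)))
          \<longlonglongrightarrow> parts_integral f f' w u v"
proof (rule LIMSEQ_I)
  fix d :: real assume d: "d > 0"
  obtain B where B: "B > 0" "\<And>s. s \<in> {u..v} \<Longrightarrow> \<bar>f' s\<bar> \<le> B"
    using C1_on_derivative_bounded[OF C1] by blast
  \<comment> \<open>The summand 1 keeps the denominator positive when u = v.\<close>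
  define e where "e = d / (2 * B * (v - u + 1))"
  have e: "e > 0" using d B uv by (auto simp: e_def)
  have "uniformly_continuous_on {u..v} w" using w by (simp add: compact_uniformly_continuous)
  then obtain \<delta> where \<delta>: "\<delta> > 0" and
    we: "\<And>s s'. s \<in> {u..v} \<Longrightarrow> s' \<in> {u..v} \<Longrightarrow> dist s' s < \<delta> \<Longrightarrow> dist (w s') (w s) < e"
    using e unfolding uniformly_continuous_on_def by blast
  have "(\<lambda>n. (v - u) * inverse (real (Suc n))) \<longlonglongrightarrow> (v - u) * 0"
    by (intro tendsto_intros LIMSEQ_inverse_real_of_nat)
  then obtain n0 where n0: "\<And>n. n \<ge> n0 \<Longrightarrow> \<bar>(v - u) * inverse (real (Suc n))\<bar> < \<delta>"
    using LIMSEQ_D[OF _ \<delta>(1)] by (metis diff_zero mult_zero_right real_norm_def)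
  show "\<exists>no. \<forall>n\<ge>no. norm ((\<Sum>k<Suc n. f (grid u v (Suc n) k) *
            (w (grid u v (Suc n) (Suc k)) - w (grid u v (Suc n) k))) - parts_integral f f' w u v) < d"
  proof (intro exI[of _ n0] allI impI)
    fix n assume n: "n \<ge> n0"
    have "\<bar>(\<Sum>j<Suc n. f (grid u v (Suc n) j) * (w (grid u v (Suc n) (Suc j)) - w (grid u v (Suc n) j)))
      - parts_integral f f' w u (grid u v (Suc n) (Suc n))\<bar> \<le> B * e * (grid u v (Suc n) (Suc n) - u)"
    proof (rule riemann_sum_error[OF C1 uv w _ B(2)])
      fix s s' assume s: "s \<in> {u..v}" "s' \<in> {u..v}" "\<bar>s - s'\<bar> \<le> (v - u) / real (Suc n)"
      have "dist s s' < \<delta>" using n0[OF n] s uv by (simp add: dist_real_def divide_inverse)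
      then show "\<bar>w s - w s'\<bar> \<le> e" using we[OF s(2,1)] by (simp add: dist_real_def)
    qed auto
    also have "B * e * (grid u v (Suc n) (Suc n) - u) = d / 2 * ((v - u) / (v - u + 1))"
      using B uv by (simp add: e_def)
    also have "\<dots> < d" 
    proof -
      have "(v - u) / (v - u + 1) \<le> 1" using uv by simp
      then have "d / 2 * ((v - u) / (v - u + 1)) \<le> d / 2 * 1" using d by (intro mult_left_mono) auto
      also have "\<dots> < d" using d by simp
      finally show ?thesis .
    qed
    finally show "norm ((\<Sum>k<Suc n. f (grid u v (Suc n) k) *
            (w (grid u v (Suc n) (Suc k)) - w (grid u v (Suc n) k))) - parts_integral f f' w u v) < d"
      by simp
  qed
qed

text \<open>
  The special case \<open>w s = s\<close>, used to pass to the limit in sums of variances.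
\<close>

lemma riemann_sums_tendsto_integral:
  assumes C1: "C1_on u v f f'" and uv: "u \<le> v"
  shows "(\<lambda>n. \<Sum>k<Suc n. f (grid u v (Suc n) k) * ((v - u) / real (Suc n))) \<longlonglongrightarrow> integral {u..v} f"
proof -
  have c: "continuous_on {u..v} f'" "continuous_on {u..v} f"
    using C1 C1_on_continuous[OF C1] by (auto simp: C1_on_def)
  have "C1_on u v (\<lambda>s. f s * s) (\<lambda>s. f' s * s + f s)"
    using C1 c unfolding C1_on_def by (auto intro!: derivative_eq_intros continuous_intros)
  from integral_C1_on[OF this uv] 
  have "integral {u..v} (\<lambda>s. f' s * s) + integral {u..v} f = f v * v - f u * u"
    by (subst (asm) Henstock_Kurzweil_Integration.integral_add)
       (auto intro!: integrable_continuous_interval continuous_intros c)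
  then have "parts_integral f f' (\<lambda>s. s) u v = integral {u..v} f"
    by (simp add: parts_integral_def)
  with riemann_sums_tendsto_parts_integral[OF C1 uv, of "\<lambda>s. s"] show ?thesis
    by (simp only: grid_step continuous_on_id)
qed

section \<open>Calculus along a path\<close>

lemma DERIV_transform:
  assumes "x \<in> A" "\<And>y. y \<in> A \<Longrightarrow> g y = f y" "(f has_real_derivative D) (at x within A)"
  shows "(g has_real_derivative D) (at x within A)"
  using has_derivative_transform[of x A g f] assms by (simp add: has_field_derivative_def)

lemma DERIV_integral_to:
  fixes g :: "real \<Rightarrow> real"
  assumes g: "continuous_on {0..t} g" and x: "x \<in> {0..t}"
  shows "((\<lambda>x. integral {x..t} g) has_real_derivative - g x) (at x within {0..t})"
proof -
  have eq: "integral {y..t} g = integral {0..t} g - integral {0..y} g" if "y \<in> {0..t}" for y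
    using Henstock_Kurzweil_Integration.integral_combine[of 0 y t g] that g
      integrable_continuous_interval[OF g] by auto
  have "((\<lambda>y. integral {0..t} g - integral {0..y} g) has_real_derivative - g x) (at x within {0..t})"
    using integral_has_real_derivative[OF g x] by (auto intro!: derivative_eq_intros)
  with x eq show ?thesis by (rule DERIV_transform)
qed

lemma DERIV_reflected:
  fixes g :: "real \<Rightarrow> real"
  assumes g: "(g has_real_derivative D) (at (t - x) within {0..t})"
  shows "((\<lambda>x. g (t - x)) has_real_derivative - D) (at x within {0..t})"
proof -
  have "y \<in> (\<lambda>x. t - x) ` {0..t}" if "y \<in> {0..t}" for y
    using that by (intro image_eqI[of _ _ "t - y"]) auto
  then have im: "(\<lambda>x. t - x) ` {0..t} = {0..t}" by auto
  have "((\<lambda>x. t - x) has_real_derivative - 1) (at x within {0..t})"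
    by (auto intro!: derivative_eq_intros)
  moreover have "(g has_real_derivative D) (at (t - x) within (\<lambda>x. t - x) ` {0..t})"
    unfolding im by (rule g)
  ultimately show ?thesis using DERIV_image_chain[of g D "\<lambda>x. t - x" x "{0..t}" "- 1"] by (simp add: comp_def)
qed

lemma DERIV_zero_endpoint:
  fixes h :: "real \<Rightarrow> real"
  assumes "\<And>x. x \<in> {0..t} \<Longrightarrow> (h has_real_derivative 0) (at x within {0..t})" "x \<in> {0..t}" "y \<in> {0..t}"
  shows "h x = h y"
  using has_field_derivative_zero_constant[of "{0..t}" h] assms by (metis convex_real_interval(5))

text \<open>
  The convolution of \<open>exp (- c s)\<close> with \<open>1 - exp (- b s)\<close>. With \<open>c = p + q\<close> it is \<open>bond_m\<close> without the
  factor \<open>p\<close>; factoring \<open>p\<close> out lets the case \<open>p = 0\<close> be treated together with the others.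
\<close>

definition discount_convolution :: "real \<Rightarrow> real \<Rightarrow> real \<Rightarrow> real" where
  "discount_convolution c b y = integral {0..y} (\<lambda>s. exp (- c * s) * (1 - exp (- b * (y - s))))"

lemma discount_convolution_0 [simp]: "discount_convolution c b 0 = 0"
  by (simp add: discount_convolution_def)

lemma integral_exp_0: "0 \<le> y \<Longrightarrow> k * integral {0..y} (\<lambda>s. exp (k * s)) = exp (k * y) - (1::real)"
proof -
  assume "0 \<le> y"
  then have "((\<lambda>s. k * exp (k * s)) has_integral exp (k * y) - exp (k * 0)) {0..y}"
    by (intro fundamental_theorem_of_calculus)
      (auto simp flip: has_real_derivative_iff_has_vector_derivative intro!: derivative_eq_intros)
  then show ?thesis by (simp add: integral_unique flip: integral_mult_right)
qed

text \<open>
  The second integral is left unevaluated: its closed form would need a case distinction on \<open>b = c\<close>.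
\<close>

lemma discount_convolution_eq:
  assumes c: "0 < c" and y: "0 \<le> y"
  shows "discount_convolution c b y =
    (1 - exp (- c * y)) / c - exp (- b * y) * integral {0..y} (\<lambda>s. exp ((b - c) * s))"
proof -
  have eq: "exp (- c * s) * (1 - exp (- b * (y - s))) = exp (- c * s) - exp (- b * y) * exp ((b - c) * s)" for s
    by (simp add: algebra_simps flip: exp_add)
  have "discount_convolution c b y =
      integral {0..y} (\<lambda>s. exp (- c * s)) - exp (- b * y) * integral {0..y} (\<lambda>s. exp ((b - c) * s))"
    unfolding discount_convolution_def eq
    by (subst Henstock_Kurzweil_Integration.integral_diff)
      (intro integrable_continuous_interval continuous_intros | simp)+
  moreover have "integral {0..y} (\<lambda>s. exp (- c * s)) = (1 - exp (- c * y)) / c"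
    using integral_exp_0[OF y, of "- c"] c by (simp add: field_simps)
  ultimately show ?thesis by simp
qed

text \<open>
  As a convolution with \<open>exp (- c s)\<close>, the function solves a linear equation with rate \<open>c\<close>. Only this
  equation and the initial value \<open>0\<close> enter the two identities about the short rate below.
\<close>

lemma DERIV_discount_convolution:
  assumes c: "0 < c" and y: "y \<in> {0..t}"
  shows "(discount_convolution c b has_real_derivative
     1 - exp (- b * y) - c * discount_convolution c b y) (at y within {0..t})"
proof -
  let ?N = "\<lambda>y. integral {0..y} (\<lambda>s. exp ((b - c) * s))"
  have "((\<lambda>y. (1 - exp (- c * y)) / c - exp (- b * y) * ?N y) has_real_derivative
      exp (- c * y) - (- b * exp (- b * y) * ?N y + exp (- b * y) * exp ((b - c) * y))) (at y within {0..t})"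
    using c by (auto intro!: derivative_eq_intros integral_has_real_derivative y continuous_intros)
  moreover have "exp (- c * y) - (- b * exp (- b * y) * ?N y + exp (- b * y) * exp ((b - c) * y)) =
      1 - exp (- b * y) - c * discount_convolution c b y"
  proof -
    have "exp (- b * y) * exp ((b - c) * y) = exp (- c * y)"
      by (simp add: algebra_simps flip: exp_add)
    moreover have "(b - c) * ?N y = exp ((b - c) * y) - 1"
      using integral_exp_0[of y "b - c"] y by simp
    moreover have "c * discount_convolution c b y = 1 - exp (- c * y) - c * exp (- b * y) * ?N y"
    proof -
      have "c * ((1 - x) / c - z) = 1 - x - c * z" for x z :: real using c by (simp add: field_simps)
      then show ?thesis using discount_convolution_eq[OF c, of y b] y by (simp add: mult.assoc)
    qed
    moreover have "Ec - (- b * E * N + E * E') = 1 - E - d"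
      if "E * E' = Ec" "(b - c) * N = E' - 1" "d = 1 - Ec - c * E * N" for E E' Ec N d :: real
      using that(1,3) arg_cong[OF that(2), of "(*) E"] by (simp add: algebra_simps)
    ultimately show ?thesis by blast
  qed
  ultimately have D: "((\<lambda>y. (1 - exp (- c * y)) / c - exp (- b * y) * ?N y) has_real_derivative
      1 - exp (- b * y) - c * discount_convolution c b y) (at y within {0..t})" by simp
  show ?thesis
    by (rule DERIV_transform[OF y _ D]) (use discount_convolution_eq[OF c] in auto)
qed

lemma continuous_discount_convolution:
  assumes "0 < c" shows "continuous_on {0..t} (discount_convolution c b)"
  by (rule DERIV_continuous_on[OF DERIV_discount_convolution[OF assms]])

lemma DERIV_discount_convolution_reflected:
  assumes c: "0 < c" and x: "x \<in> {0..t}"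
  shows "((\<lambda>x. discount_convolution c b (t - x)) has_real_derivative
     - (1 - exp (- b * (t - x)) - c * discount_convolution c b (t - x))) (at x within {0..t})"
  using x by (intro DERIV_reflected DERIV_discount_convolution c) auto

lemma DERIV_integral_reflected:
  fixes g :: "real \<Rightarrow> real"
  assumes g: "continuous_on {0..t} g" and x: "x \<in> {0..t}"
  shows "((\<lambda>x. integral {0..t - x} g) has_real_derivative - g (t - x)) (at x within {0..t})"
  using x by (intro DERIV_reflected[where g = "\<lambda>y. integral {0..y} g"] integral_has_real_derivative g) auto

locale memory_parameters =
  fixes p q :: real
  assumes q_pos: "0 < q" and p_gt: "- q < p"
begin

text \<open>
  With \<open>\<rho> = p / (p + 2 q)\<close>, the integrand of \<open>bond_U\<close> is \<open>theta s = exp (q s) - \<rho> exp (- q s)\<close>, and with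
  \<open>psi s = exp (q s) - \<rho>\<^sup>2 exp (- q s)\<close> the function \<open>memory_l\<close> is the quotient \<open>theta / psi\<close>. The quotient
  form exposes \<open>psi\<close>, which turns out to be the integrating factor of the inner process.
\<close>

definition theta :: "real \<Rightarrow> real" where "theta s = exp (q * s) - p / (p + 2 * q) * exp (- q * s)"
definition theta' :: "real \<Rightarrow> real" where "theta' s = q * exp (q * s) + q * (p / (p + 2 * q)) * exp (- q * s)"
definition psi :: "real \<Rightarrow> real" where "psi s = exp (q * s) - (p / (p + 2 * q))\<^sup>2 * exp (- q * s)"
definition psi' :: "real \<Rightarrow> real" where "psi' s = q * exp (q * s) + q * (p / (p + 2 * q))\<^sup>2 * exp (- q * s)"
definition memory_l' :: "real \<Rightarrow> real" where "memory_l' s = (theta' s * psi s - theta s * psi' s) / (psi s)\<^sup>2"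
definition memory_denom :: "real \<Rightarrow> real" where "memory_denom s = (p + 2 * q)\<^sup>2 * exp (2 * q * s) - p\<^sup>2"

lemma p2q_pos: "0 < p + 2 * q" using q_pos p_gt by simp
lemma p2q_nonzero [simp]: "p + 2 * q \<noteq> 0" using p2q_pos by simp
lemma pq_pos: "0 < p + q" using p_gt by simp

lemma memory_denom_psi: "memory_denom s = (p + 2 * q)\<^sup>2 * exp (q * s) * psi s"
proof -
  have "exp (2 * q * s) = exp (q * s) * exp (q * s)" "exp (q * s) * exp (- q * s) = 1"
    by (simp_all flip: exp_add)
  moreover have "(p + 2 * q)\<^sup>2 * (p / (p + 2 * q))\<^sup>2 = p\<^sup>2" using p2q_pos by (simp add: power_divide)
  moreover have "(p + 2 * q)\<^sup>2 * exp (q * s) * psi s = (p + 2 * q)\<^sup>2 * (exp (q * s) * exp (q * s)) -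
      ((p + 2 * q)\<^sup>2 * (p / (p + 2 * q))\<^sup>2) * (exp (q * s) * exp (- q * s))"
    unfolding psi_def right_diff_distrib by (simp only: mult_ac)
  ultimately show ?thesis by (simp add: memory_denom_def)
qed

lemma memory_denom_pos:
  assumes "0 \<le> s" shows "0 < memory_denom s"
proof -
  have "(p + 2 * q)\<^sup>2 - p\<^sup>2 = 4 * q * (p + q)" by (simp add: power2_eq_square algebra_simps)
  then have "p\<^sup>2 < (p + 2 * q)\<^sup>2" using q_pos pq_pos by (smt (verit) mult_pos_pos)
  also have "\<dots> \<le> (p + 2 * q)\<^sup>2 * exp (2 * q * s)"
    using q_pos assms by (simp add: mult_le_cancel_left1)
  finally show ?thesis by (simp add: memory_denom_def)
qed

lemma psi_pos: "0 \<le> s \<Longrightarrow> 0 < psi s"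
  using memory_denom_pos[of s] p2q_pos unfolding memory_denom_psi
  by (metis exp_gt_zero less_asym zero_less_mult_iff zero_less_power)

text \<open>
  With \<open>\<rho> = p / (p + 2 q)\<close> as above, the identity \<open>\<rho>\<^sup>2 + 2 q p / (p + 2 q)\<^sup>2 = \<rho>\<close> is what combines the two terms of \<open>memory_l\<close>.
\<close>

lemma memory_l_eq:
  assumes "0 \<le> s" shows "memory_l p q s = theta s / psi s"
proof -
  have e: "exp (q * s) * exp (- q * s) = 1" by (simp flip: exp_add)
  have "memory_l p q s = 1 - 2 * q * p / memory_denom s" by (simp add: memory_l_def memory_denom_def)
  also have "2 * q * p / memory_denom s = (2 * q * p / (p + 2 * q)\<^sup>2) * exp (- q * s) / psi s"
    using e unfolding memory_denom_psi by (simp add: exp_minus field_simps)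
  also have "1 - \<dots> = (psi s - (2 * q * p / (p + 2 * q)\<^sup>2) * exp (- q * s)) / psi s"
    using psi_pos[OF assms] by (simp add: field_simps)
  also have "psi s - (2 * q * p / (p + 2 * q)\<^sup>2) * exp (- q * s) = theta s"
  proof -
    have "p\<^sup>2 + 2 * q * p = p * (p + 2 * q)" by (simp add: power2_eq_square algebra_simps)
    then have "(p / (p + 2 * q))\<^sup>2 + 2 * q * p / (p + 2 * q)\<^sup>2 = p * (p + 2 * q) / (p + 2 * q)\<^sup>2"
      unfolding power_divide by (metis add_divide_distrib)
    also have "\<dots> = p / (p + 2 * q)" by (simp add: power2_eq_square)
    finally have "theta s = exp (q * s) -
        ((p / (p + 2 * q))\<^sup>2 + 2 * q * p / (p + 2 * q)\<^sup>2) * exp (- q * s)"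
      by (simp only: theta_def)
    then show ?thesis unfolding psi_def by (simp add: distrib_right)
  qed
  finally show ?thesis .
qed

text \<open>
  This relation is the reason why the inner process can be recovered from \<open>Z\<close> through \<open>theta\<close>: driven by \<open>Z\<close>
  instead of \<open>W\<close>, the inner process has the linear drift rate \<open>- (p + q) + p * memory_l\<close>, and
  after division by \<open>psi\<close> the relation says that this is the logarithmic derivative of \<open>1 / psi\<close>.
\<close>

lemma psi_ode: "(p + q) * psi s - psi' s - p * theta s = 0"
proof -
  define \<rho> where "\<rho> = p / (p + 2 * q)"
  have "\<rho> * (p + 2 * q) = p" using p2q_pos by (simp add: \<rho>_def)
  then have "p * \<rho> - (p + 2 * q) * \<rho>\<^sup>2 = 0" by (simp add: power2_eq_square mult.commute)
  moreover have "(p + q) * psi s - psi' s - p * theta s = (p * \<rho> - (p + 2 * q) * \<rho>\<^sup>2) * exp (- q * s)"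
    unfolding psi_def psi'_def theta_def \<rho>_def[symmetric] by (simp add: algebra_simps)
  ultimately show ?thesis by simp
qed

lemma DERIV_theta: "(theta has_real_derivative theta' s) (at s within A)"
  unfolding theta_def[abs_def] theta'_def by (auto intro!: derivative_eq_intros)

lemma DERIV_psi: "(psi has_real_derivative psi' s) (at s within A)"
  unfolding psi_def[abs_def] psi'_def by (auto intro!: derivative_eq_intros)

lemma continuous_memory [continuous_intros]:
  "continuous_on A theta" "continuous_on A theta'" "continuous_on A psi" "continuous_on A psi'"
  unfolding theta_def[abs_def] theta'_def[abs_def] psi_def[abs_def] psi'_def[abs_def]
  by (intro continuous_intros)+

lemma continuous_memory_l' [continuous_intros]: "continuous_on {0..t} memory_l'"
  unfolding memory_l'_def[abs_def] using psi_pos by (intro continuous_intros) force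

lemma DERIV_memory_l:
  assumes s: "s \<in> {0..t}"
  shows "(memory_l p q has_real_derivative memory_l' s) (at s within {0..t})"
proof -
  have D: "((\<lambda>s. theta s / psi s) has_real_derivative memory_l' s) (at s within {0..t})"
    unfolding memory_l'_def using psi_pos[of s] s
    by (auto intro!: derivative_eq_intros DERIV_theta DERIV_psi simp: power2_eq_square)
  show ?thesis by (rule DERIV_transform[OF s _ D]) (simp add: memory_l_eq)
qed

lemma continuous_memory_l [continuous_intros]: "continuous_on {0..t} (memory_l p q)"
  using DERIV_memory_l by (rule DERIV_continuous_on)

lemma C1_on_theta: "C1_on 0 t theta theta'"
  by (simp add: C1_on_def DERIV_theta continuous_memory)

text \<open>
  The integrand of the inner process at time \<open>s\<close> factors as \<open>exp (- (p + q) s) * memory_kernel \<tau>\<close>, so a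
  single integral with an integrand independent of \<open>s\<close> gives the whole path of the inner process.
\<close>

definition memory_kernel :: "real \<Rightarrow> real" where
  "memory_kernel s = p * exp ((p + q) * s) * memory_l p q s"
definition memory_kernel' :: "real \<Rightarrow> real" where
  "memory_kernel' s = p * exp ((p + q) * s) * ((p + q) * memory_l p q s + memory_l' s)"

lemma C1_on_memory_kernel: "C1_on 0 t memory_kernel memory_kernel'"
  unfolding C1_on_def memory_kernel_def[abs_def] memory_kernel'_def[abs_def]
  by (auto intro!: derivative_eq_intros DERIV_memory_l continuous_intros simp: algebra_simps)

definition inner_path :: "(real \<Rightarrow> real) \<Rightarrow> real \<Rightarrow> real" where
  "inner_path w s = exp (- (p + q) * s) * parts_integral memory_kernel memory_kernel' w 0 s"

text \<open>
  The continuously differentiable part of the inner path: by parts, the path equals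
  \<open>p * memory_l p q s * w s\<close> minus this function, and only the first term is as rough as \<open>w\<close>.
\<close>

definition inner_smooth :: "(real \<Rightarrow> real) \<Rightarrow> real \<Rightarrow> real" where
  "inner_smooth w s = exp (- (p + q) * s) * integral {0..s} (\<lambda>u. memory_kernel' u * w u)"

lemma exp_memory_kernel:
  "exp (- (p + q) * s) * memory_kernel s = p * memory_l p q s"
  "exp (- (p + q) * s) * memory_kernel' s = p * ((p + q) * memory_l p q s + memory_l' s)"
proof -
  have 1: "exp (- (p + q) * s) * exp ((p + q) * s) = 1" by (simp add: algebra_simps flip: exp_add)
  have "exp (- (p + q) * s) * (p * exp ((p + q) * s) * x) =
      (exp (- (p + q) * s) * exp ((p + q) * s)) * (p * x)" for x by (simp only: mult_ac)
  then have "exp (- (p + q) * s) * (p * exp ((p + q) * s) * x) = p * x" for x unfolding 1 by simp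
  then show "exp (- (p + q) * s) * memory_kernel s = p * memory_l p q s"
    "exp (- (p + q) * s) * memory_kernel' s = p * ((p + q) * memory_l p q s + memory_l' s)"
    unfolding memory_kernel_def memory_kernel'_def by blast+
qed

lemma exp_times_memory_kernel: "exp (- (p + q) * s) * memory_kernel \<tau> = p * exp (- (p + q) * (s - \<tau>)) * memory_l p q \<tau>"
proof -
  have "- (p + q) * (s - \<tau>) = - (p + q) * s + (p + q) * \<tau>" by (simp add: algebra_simps)
  then have "exp (- (p + q) * (s - \<tau>)) = exp (- (p + q) * s) * exp ((p + q) * \<tau>)"
    by (simp only: exp_add)
  then show ?thesis by (simp only: memory_kernel_def mult_ac)
qed

lemma inner_path_eq:
  assumes "w 0 = 0"
  shows "inner_path w s = p * memory_l p q s * w s - inner_smooth w s"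
  using exp_memory_kernel(1)[of s]
  by (simp add: inner_path_def inner_smooth_def parts_integral_def assms right_diff_distrib
      flip: mult.assoc)

lemma continuous_memory_kernel' [continuous_intros]: "continuous_on {0..t} memory_kernel'"
  using C1_on_memory_kernel by (simp add: C1_on_def)

lemma DERIV_inner_smooth:
  assumes w: "continuous_on {0..t} w" and s: "s \<in> {0..t}"
  shows "(inner_smooth w has_real_derivative
     - (p + q) * inner_smooth w s + p * ((p + q) * memory_l p q s + memory_l' s) * w s) (at s within {0..t})"
proof -
  have "((\<lambda>s. exp (- (p + q) * s) * integral {0..s} (\<lambda>u. memory_kernel' u * w u)) has_real_derivative
      - (p + q) * exp (- (p + q) * s) * integral {0..s} (\<lambda>u. memory_kernel' u * w u) +
      exp (- (p + q) * s) * (memory_kernel' s * w s)) (at s within {0..t})"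
    by (auto intro!: derivative_eq_intros integral_has_real_derivative s continuous_intros w)
  then show ?thesis
    unfolding inner_smooth_def[abs_def] using exp_memory_kernel(2)[of s] by (simp add: mult.assoc[symmetric])
qed

lemma continuous_inner_path:
  assumes w: "continuous_on {0..t} w" and w0: "w 0 = 0"
  shows "continuous_on {0..t} (inner_path w)"
proof -
  have "inner_path w = (\<lambda>s. p * memory_l p q s * w s - inner_smooth w s)"
    using inner_path_eq[where w = w, OF w0] by auto
  then show ?thesis
    by (simp only:) (intro continuous_intros w DERIV_continuous_on[OF DERIV_inner_smooth[OF w]])
qed

text \<open>
  The inner process is a functional of the path of \<open>Z\<close>. Formally \<open>dY = - (p + q) Y dt + p l dw\<close> and
  \<open>dZ = dw - Y dt\<close>, so \<open>dY = (p l - (p + q)) Y dt + p l dZ\<close>, a linear equation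
  with integrating factor \<open>psi\<close>; since \<open>psi * l = theta\<close>, its solution is \<open>psi Y = p \<integral> theta dZ\<close>.

  As \<open>w\<close> is not differentiable, the two sides are first written so that the terms containing \<open>w\<close> itself
  cancel. The remaining difference \<open>H\<close> is continuously differentiable, starts at \<open>0\<close>, and has
  derivative \<open>0\<close>.
\<close>

lemma inner_path_from_Z:
  assumes w: "continuous_on {0..t} w" and w0: "w 0 = 0" and t: "0 \<le> t"
  shows "inner_path w t * memory_denom t = p * (p + 2 * q)\<^sup>2 * exp (q * t) *
    (parts_integral theta theta' w 0 t - integral {0..t} (\<lambda>s. theta s * inner_path w s))"
proof -
  note cY = continuous_inner_path[OF w w0]
  define H where "H s = p * integral {0..s} (\<lambda>s. theta' s * w s) +
      p * integral {0..s} (\<lambda>s. theta s * inner_path w s) - inner_smooth w s * psi s" for s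
  have "(H has_real_derivative 0) (at s within {0..t})" if s: "s \<in> {0..t}" for s
  proof -
    have "(H has_real_derivative p * (theta' s * w s) + p * (theta s * inner_path w s) -
       ((- (p + q) * inner_smooth w s + p * ((p + q) * memory_l p q s + memory_l' s) * w s) * psi s +
        psi' s * inner_smooth w s)) (at s within {0..t})"
      unfolding H_def[abs_def]
      by (auto intro!: derivative_eq_intros integral_has_real_derivative DERIV_inner_smooth w s DERIV_psi
          continuous_intros cY)
    moreover have "p * (theta' s * w s) + p * (theta s * inner_path w s) -
       ((- (p + q) * inner_smooth w s + p * ((p + q) * memory_l p q s + memory_l' s) * w s) * psi s +
        psi' s * inner_smooth w s) = 0"
    proof -
      \<comment> \<open>The product rule for memory_l * psi = theta.\<close>
      have "theta' s - memory_l p q s * psi' s - memory_l' s * psi s = 0"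
        using psi_pos[of s] s by (simp add: memory_l_eq memory_l'_def field_simps power2_eq_square)
      moreover have "p * (theta' s * w s) + p * (theta s * inner_path w s) -
         ((- (p + q) * inner_smooth w s + p * ((p + q) * memory_l p q s + memory_l' s) * w s) * psi s +
          psi' s * inner_smooth w s) =
        (inner_smooth w s - p * w s * memory_l p q s) * ((p + q) * psi s - psi' s - p * theta s)
        + p * w s * (theta' s - memory_l p q s * psi' s - memory_l' s * psi s)"
        unfolding inner_path_eq[where w = w, OF w0] by (simp add: algebra_simps)
      ultimately show ?thesis using psi_ode[of s] by simp
    qed
    ultimately show ?thesis by simp
  qed
  from DERIV_zero_endpoint[OF this, of t 0] have "H t = H 0" using t by auto
  also have "H 0 = 0" by (simp add: H_def inner_smooth_def)
  finally have "H t = 0" .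
  moreover have "inner_path w t * psi t = p * theta t * w t - inner_smooth w t * psi t"
    using psi_pos[OF t] by (simp add: inner_path_eq[where w = w, OF w0] memory_l_eq[OF t] field_simps)
  ultimately have "inner_path w t * psi t =
     p * (parts_integral theta theta' w 0 t - integral {0..t} (\<lambda>s. theta s * inner_path w s))"
    unfolding H_def parts_integral_def w0 by (simp add: algebra_simps)
  moreover have "inner_path w t * memory_denom t = (p + 2 * q)\<^sup>2 * exp (q * t) * (inner_path w t * psi t)"
    unfolding memory_denom_psi by (simp only: mult_ac)
  ultimately show ?thesis by (simp only: mult_ac)
qed

text \<open>
  The total weight with which the increment \<open>dw\<close> at time \<open>v\<close> enters \<open>\<integral> r\<close> up to time \<open>T\<close>, divided by
  \<open>\<sigma>\<close>: a direct effect \<open>(1 - exp (- b (T - v))) / b\<close> through mean reversion, less the effect through all later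
  values of the inner process.
\<close>

definition loading :: "real \<Rightarrow> real \<Rightarrow> real \<Rightarrow> real" where
  "loading b T v = (1 - exp (- b * (T - v)) - p * memory_l p q v * discount_convolution (p + q) b (T - v)) / b"

definition loading' :: "real \<Rightarrow> real \<Rightarrow> real \<Rightarrow> real" where
  "loading' b T v = - exp (- b * (T - v)) - p / b * (memory_l' v * discount_convolution (p + q) b (T - v) -
     memory_l p q v * (1 - exp (- b * (T - v)) - (p + q) * discount_convolution (p + q) b (T - v)))"

lemma continuous_discount_convolution_reflected [continuous_intros]:
  "continuous_on {0..T} (\<lambda>v. discount_convolution (p + q) b (T - v))"
  by (rule DERIV_continuous_on[OF DERIV_discount_convolution_reflected[OF pq_pos]])

lemma C1_on_loading:
  assumes b: "0 < b"
  shows "C1_on 0 T (loading b T) (loading' b T)"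
  unfolding C1_on_def
proof (intro conjI ballI)
  fix v assume v: "v \<in> {0..T}"
  have "((\<lambda>v. (1 - exp (- b * (T - v)) - p * memory_l p q v * discount_convolution (p + q) b (T - v)) / b)
     has_real_derivative (- (b * exp (- b * (T - v))) - (p * memory_l' v * discount_convolution (p + q) b (T - v) +
       - (1 - exp (- b * (T - v)) - (p + q) * discount_convolution (p + q) b (T - v)) * (p * memory_l p q v))) / b)
     (at v within {0..T})"
    using b by (auto intro!: derivative_eq_intros DERIV_memory_l DERIV_discount_convolution_reflected pq_pos v)
  moreover have "(- (b * e) - (p * l * n + - (1 - e - k * n) * (p * m))) / b =
    - e - p / b * (l * n - m * (1 - e - k * n))" for e l n k m :: real
    using b by (simp add: field_simps)
  ultimately show "(loading b T has_real_derivative loading' b T v) (at v within {0..T})"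
    unfolding loading_def[abs_def] loading'_def by simp
next
  show "continuous_on {0..T} (loading' b T)"
    unfolding loading'_def[abs_def] by (intro continuous_intros)
qed

text \<open>
  The future integral of the rate is affine in the two state variables \<open>r t\<close> and \<open>Y t\<close> plus a term
  driven by the increments of \<open>w\<close> after \<open>t\<close>. Heuristically, \<open>\<integral>\<^sub>t\<^sup>T r = C r + (a / b) (T - t - C) + \<sigma> \<integral>\<^sub>t\<^sup>T C(u, T) dZ(u)\<close>, in
  which one inserts \<open>dZ = dw - Y du\<close> and \<open>Y u = exp (- (p + q) (u - t)) Y t + \<dots>\<close> and exchanges the
  order of integration. The exchange is avoided by differentiating in the lower end point: after
  removal of the rough parts \<open>\<sigma> w\<close> of \<open>r\<close> and \<open>p l w\<close> of \<open>Y\<close>, which cancel against the boundary term of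
  the loading, the difference \<open>H\<close> of both sides is constant and vanishes at \<open>T\<close>.
\<close>

lemma integral_rate_path:
  assumes w: "continuous_on {0..T} w" and w0: "w 0 = 0" and b: "0 < b"
    and rc: "continuous_on {0..T} r"
    and r: "\<And>x. x \<in> {0..T} \<Longrightarrow> r x = r0 + integral {0..x} (\<lambda>s. a - b * r s)
        + \<sigma> * (w x - integral {0..x} (inner_path w))"
    and t: "0 \<le> t" "t \<le> T"
  shows "integral {t..T} r = bond_C b t T * r t + a / b * (T - t - bond_C b t T)
    - \<sigma> * discount_convolution (p + q) b (T - t) / b * inner_path w t
    + \<sigma> * parts_integral (loading b T) (loading' b T) w t T"
proof -
  let ?n = "\<lambda>x. discount_convolution (p + q) b (T - x)"
  note cY = continuous_inner_path[OF w w0]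
  have cl: "continuous_on {0..T} (loading' b T)" using C1_on_loading[OF b] by (simp add: C1_on_def)
  define R where "R x = r0 + integral {0..x} (\<lambda>s. a - b * r s) - \<sigma> * integral {0..x} (inner_path w)" for x
  have rR: "r x = R x + \<sigma> * w x" if "x \<in> {0..T}" for x
    using r[OF that] by (simp add: R_def algebra_simps)
  have DR: "(R has_real_derivative a - b * r x - \<sigma> * inner_path w x) (at x within {0..T})" if "x \<in> {0..T}" for x
    unfolding R_def[abs_def]
    by (auto intro!: derivative_eq_intros integral_has_real_derivative that continuous_intros rc cY)
  define H where "H x = integral {x..T} r - (1 - exp (- b * (T - x))) / b * R x
      - a / b * (T - x - (1 - exp (- b * (T - x))) / b) - \<sigma> / b * (?n x * inner_smooth w x)
      + \<sigma> * integral {x..T} (\<lambda>s. loading' b T s * w s)" for x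
  have "(H has_real_derivative 0) (at x within {0..T})" if x: "x \<in> {0..T}" for x
  proof -
    let ?e = "exp (- b * (T - x))" and ?y = "inner_smooth w x" and ?l = "memory_l p q x"
    let ?y' = "- (p + q) * inner_smooth w x + p * ((p + q) * memory_l p q x + memory_l' x) * w x"
    let ?n' = "- (1 - ?e - (p + q) * ?n x)"
    have "(H has_real_derivative - r x - (- (b * ?e) / b * R x + (a - b * r x - \<sigma> * inner_path w x) * ((1 - ?e) / b))
      - a / b * (- 1 - - (b * ?e) / b) - \<sigma> / b * (?n' * ?y + ?y' * ?n x)
      + \<sigma> * - (loading' b T x * w x)) (at x within {0..T})"
      unfolding H_def[abs_def] using b
      by (auto intro!: derivative_eq_intros DERIV_integral_to DR DERIV_inner_smooth
          DERIV_discount_convolution_reflected pq_pos x w rc continuous_intros cl) (simp add: field_simps)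
    moreover have "- (\<rho> + \<sigma> * z) - (- (b * e) / b * \<rho> + (a - b * (\<rho> + \<sigma> * z) - \<sigma> * (p * l * z - y)) * ((1 - e) / b))
      - a / b * (- 1 - - (b * e) / b) - \<sigma> / b * (- (1 - e - k * n) * y + (- k * y + p * (k * l + d) * z) * n)
      + \<sigma> * - ((- e - p / b * (d * n - l * (1 - e - k * n))) * z) = 0" for \<rho> z e y l k n d :: real
      using b by (simp add: field_simps)
    ultimately show ?thesis
      by (simp only: rR[OF x] inner_path_eq[where w = w, OF w0] loading'_def)
  qed
  from DERIV_zero_endpoint[OF this, of t T] have "H t = H T" using t by auto
  also have "H T = 0" by (simp add: H_def)
  finally have "H t = 0" .
  \<comment> \<open>No boundary term at the maturity, and the one at t cancels the rough parts.\<close>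
  moreover have "loading b T T = 0" by (simp add: loading_def)
  moreover have "R t = r t - \<sigma> * w t" using rR[of t] t by simp
  moreover have "x - (1 - e) / b * (\<rho> - \<sigma> * z) - A - \<sigma> / b * (n * y) + \<sigma> * I = 0 \<Longrightarrow>
     x = (1 - e) / b * \<rho> + A - \<sigma> * n / b * (p * l * z - y) + \<sigma> * (0 * zT - (1 - e - p * l * n) / b * z - I)"
    for x e \<rho> z n y I A l zT :: real
  proof -
    assume "x - (1 - e) / b * (\<rho> - \<sigma> * z) - A - \<sigma> / b * (n * y) + \<sigma> * I = 0"
    then have "x = (1 - e) / b * (\<rho> - \<sigma> * z) + A + \<sigma> / b * (n * y) - \<sigma> * I" by simp
    also have "\<dots> = (1 - e) / b * \<rho> + A - \<sigma> * n / b * (p * l * z - y) +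
        \<sigma> * (0 * zT - (1 - e - p * l * n) / b * z - I)"
      using b by (simp add: field_simps)
    finally show ?thesis .
  qed
  ultimately show ?thesis
    unfolding H_def parts_integral_def inner_path_eq[where w = w, OF w0] bond_C_def loading_def
    by (metis (no_types, lifting))
qed

lemma DERIV_memory_denom: "(memory_denom has_real_derivative 2 * q * (memory_denom s + p\<^sup>2)) (at s within A)"
  unfolding memory_denom_def[abs_def] by (auto intro!: derivative_eq_intros)

text \<open>
  With \<open>m = p * discount_convolution (p + q) b\<close> and \<open>E s = 1 - exp (- b s)\<close>, both taken at \<open>T - v\<close>, and
  \<open>k = 1 - memory_l p q\<close>, the integrand on the left times \<open>b\<^sup>2\<close> is \<open>(E - m + k m)\<^sup>2\<close>. Its excess over \<open>(m - E)\<^sup>2\<close> is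
  \<open>2 k m (E - m) + k\<^sup>2 m\<^sup>2\<close>, which is minus the exact \<open>v\<close>-derivative of \<open>2 q m\<^sup>2 / memory_denom\<close> because
  \<open>m' = p E - (p + q) m\<close> and \<open>memory_denom' = 2 q (memory_denom + p\<^sup>2)\<close>.
\<close>

lemma integral_loading_square:
  assumes b: "0 < b" and t: "0 \<le> t" "t \<le> T"
  shows "b\<^sup>2 * integral {t..T} (\<lambda>v. (loading b T v)\<^sup>2) =
    integral {0..T - t} (\<lambda>s. (p * discount_convolution (p + q) b s + exp (- b * s) - 1)\<^sup>2)
    + 2 * q * (p * discount_convolution (p + q) b (T - t))\<^sup>2 / memory_denom t"
proof -
  let ?n = "\<lambda>x. discount_convolution (p + q) b (T - x)"
  have cm: "continuous_on {0..T} (discount_convolution (p + q) b)"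
    by (rule continuous_discount_convolution[OF pq_pos])
  have cl: "continuous_on {0..T} (loading b T)" by (rule C1_on_continuous[OF C1_on_loading[OF b]])
  define H where "H x = b\<^sup>2 * integral {x..T} (\<lambda>v. (loading b T v)\<^sup>2) -
    integral {0..T - x} (\<lambda>s. (p * discount_convolution (p + q) b s + exp (- b * s) - 1)\<^sup>2)
    - 2 * q * p\<^sup>2 * (?n x * ?n x * inverse (memory_denom x))" for x
  have "(H has_real_derivative 0) (at x within {0..T})" if x: "x \<in> {0..T}" for x
  proof -
    have d: "memory_denom x \<noteq> 0" using memory_denom_pos[of x] x by simp
    let ?e = "exp (- b * (T - x))" and ?l = "memory_l p q x"
    let ?n' = "- (1 - ?e - (p + q) * ?n x)"
    let ?i = "inverse (memory_denom x)"
    have "(H has_real_derivative b\<^sup>2 * - (loading b T x)\<^sup>2 - - (p * ?n x + ?e - 1)\<^sup>2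
      - 2 * q * p\<^sup>2 * ((?n' * ?n x + ?n' * ?n x) * ?i +
          - (?i * (2 * q * (memory_denom x + p\<^sup>2)) * ?i) * (?n x * ?n x))) (at x within {0..T})"
      unfolding H_def[abs_def]
      by (auto intro!: derivative_eq_intros DERIV_integral_to DERIV_integral_reflected DERIV_memory_denom
          DERIV_discount_convolution_reflected pq_pos x d continuous_intros cm cl)
    moreover have "b\<^sup>2 * (loading b T x)\<^sup>2 = (1 - ?e - p * ?l * ?n x)\<^sup>2"
      using b by (simp add: loading_def power_divide)
    moreover have "?l = 1 - 2 * q * p * ?i"
      by (simp add: memory_l_def memory_denom_def divide_inverse)
    moreover have "- (1 - e - p * (1 - 2 * q * p * i) * n)\<^sup>2 + (p * n + e - 1)\<^sup>2
      - 2 * q * p\<^sup>2 * ((- (1 - e - (p + q) * n) * n + - (1 - e - (p + q) * n) * n) * i +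
          - (2 * q * (i + p\<^sup>2 * (i * i))) * (n * n)) = 0" for e n i :: real
      by (simp add: power2_eq_square algebra_simps)
    moreover have "?i * (2 * q * (memory_denom x + p\<^sup>2)) * ?i = 2 * q * (?i + p\<^sup>2 * (?i * ?i))"
      using d by (simp add: field_simps)
    ultimately show ?thesis by simp
  qed
  from DERIV_zero_endpoint[OF this, of t T] have "H t = H T" using t by auto
  also have "H T = 0" by (simp add: H_def)
  finally show ?thesis by (simp add: H_def divide_inverse power2_eq_square algebra_simps)
qed

end

section \<open>Increments of Brownian motion and the augmented filtration\<close>

text \<open>
  Used with \<open>N\<close> a member of the augmented filtration: almost sure limits stay adapted.
\<close>

lemma (in complete_measure) measurable_AE_cong_complete:
  fixes f g :: "'a \<Rightarrow> real"
  assumes sp: "space N = space M" and null: "null_sets M \<subseteq> sets N"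
    and f: "f \<in> borel_measurable N" and eq: "AE \<omega> in M. f \<omega> = g \<omega>"
  shows "g \<in> borel_measurable N"
proof (rule measurableI)
  fix B :: "real set" assume B: "B \<in> sets borel"
  obtain A where A: "A \<in> null_sets M" "{\<omega>\<in>space M. f \<omega> \<noteq> g \<omega>} \<subseteq> A"
    using eq by (auto elim!: AE_E3)
  have "f -` B \<inter> space M \<in> sets N" using measurable_sets[OF f B] sp by simp
  moreover have "(f -` B \<inter> space M) \<inter> A \<in> sets N" "(g -` B \<inter> space M) \<inter> A \<in> sets N"
    using A(1) null complete2 by (metis inf_le2 subsetD)+
  moreover have "g -` B \<inter> space N =
     ((f -` B \<inter> space M) - (f -` B \<inter> space M) \<inter> A) \<union> ((g -` B \<inter> space M) \<inter> A)"
    using A sp by auto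
  ultimately show "g -` B \<inter> space N \<in> sets N" by (metis sets.Diff sets.Un)
qed simp

locale augmented_brownian_motion = prob_space Q + complete_measure Q
  for Q :: "'a measure" and F :: "real \<Rightarrow> 'a measure" and W :: "real \<Rightarrow> 'a \<Rightarrow> real" +
  assumes brownian: "standard_brownian_motion Q W"
    and F_def: "F = augmented_filtration Q W"
begin

lemma W_measurable [measurable]: "0 \<le> t \<Longrightarrow> W t \<in> borel_measurable Q"
  using brownian by (simp add: standard_brownian_motion_def)

lemma AE_W_0: "AE \<omega> in Q. W 0 \<omega> = 0"
  using brownian by (simp add: standard_brownian_motion_def)

lemma AE_W_continuous: "AE \<omega> in Q. continuous_on {0..} (\<lambda>t. W t \<omega>)"
  using brownian by (simp add: standard_brownian_motion_def)

lemma natural_generator_subset: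
  "{W s -` B \<inter> space Q | s B. 0 \<le> s \<and> s \<le> t \<and> B \<in> sets borel} \<subseteq> sets Q"
  by (auto intro!: measurable_sets[OF W_measurable])

lemma sets_natural:
  "sets (natural_filtration Q W t) =
     sigma_sets (space Q) {W s -` B \<inter> space Q | s B. 0 \<le> s \<and> s \<le> t \<and> B \<in> sets borel}"
  unfolding natural_filtration_def by (rule sets_measure_of) auto

lemma sets_natural_subset: "sets (natural_filtration Q W t) \<subseteq> sets Q"
  unfolding sets_natural by (rule sets.sigma_sets_subset[OF natural_generator_subset])

lemma sets_F: "sets (F t) = sigma_sets (space Q) (sets (natural_filtration Q W t) \<union> null_sets Q)"
  unfolding F_def augmented_filtration_def using sets_natural_subset[of t]
  by (intro sets_measure_of) (auto dest: sets.sets_into_space)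

lemma space_F [simp]: "space (F t) = space Q"
  unfolding F_def augmented_filtration_def using sets_natural_subset[of t]
  by (intro space_measure_of) (auto dest: sets.sets_into_space)

lemma sets_F_subset: "sets (F t) \<subseteq> sets Q"
  unfolding sets_F using sets_natural_subset[of t] by (intro sets.sigma_sets_subset) auto

lemma subalgebra_F: "subalgebra Q (F t)"
  using sets_F_subset by (simp add: subalgebra_def)

lemma sets_F_mono: "s \<le> t \<Longrightarrow> sets (F s) \<subseteq> sets (F t)"
  unfolding sets_F sets_natural by (intro sigma_sets_mono' Un_mono order_refl) (blast intro: order_trans)

lemma measurable_F_imp_Q: "f \<in> borel_measurable (F t) \<Longrightarrow> f \<in> borel_measurable Q"
  by (rule measurable_from_subalg[OF subalgebra_F])

lemma measurable_F_mono: "f \<in> borel_measurable (F s) \<Longrightarrow> s \<le> t \<Longrightarrow> f \<in> borel_measurable (F t)"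
  by (rule measurable_from_subalg[of _ "F s"]) (auto simp: subalgebra_def dest: sets_F_mono)

lemma null_sets_in_F: "N \<in> null_sets Q \<Longrightarrow> N \<in> sets (F t)"
  unfolding sets_F by auto

lemma W_measurable_F: 
  assumes "0 \<le> s" "s \<le> t" shows "W s \<in> borel_measurable (F t)"
proof (rule measurableI)
  fix B :: "real set" assume "B \<in> sets borel"
  then have "W s -` B \<inter> space Q \<in> sets (natural_filtration Q W t)"
    unfolding sets_natural using assms by blast
  then show "W s -` B \<inter> space (F t) \<in> sets (F t)"
    unfolding sets_F by auto
qed simp

lemma measurable_F_AE_cong:
  fixes f g :: "'a \<Rightarrow> real"
  assumes "f \<in> borel_measurable (F t)" "AE \<omega> in Q. f \<omega> = g \<omega>"
  shows "g \<in> borel_measurable (F t)"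
  using assms by (intro measurable_AE_cong_complete[of "F t" f g]) (auto intro: null_sets_in_F)

lemma measurable_Q_AE_cong:
  fixes f g :: "'a \<Rightarrow> real"
  assumes "f \<in> borel_measurable Q" "AE \<omega> in Q. f \<omega> = g \<omega>"
  shows "g \<in> borel_measurable Q"
  using assms by (intro measurable_AE_cong_complete[of Q f g]) auto

text \<open>
  Augmentation preserves independence of future increments because adjoining the null sets to a
  \<open>\<sigma>\<close>-algebra keeps it stable under intersection, and null events are independent of everything.
\<close>

lemma indep_set_F_increment:
  assumes st: "0 \<le> s" "s < t"
  shows "indep_set (sets (F s))
    (sigma_sets (space Q) {(\<lambda>\<omega>. W t \<omega> - W s \<omega>) -` B \<inter> space Q | B. B \<in> sets borel})"
    (is "indep_set _ (sigma_sets _ ?I)")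
proof -
  have ind: "indep_set (sets (natural_filtration Q W s)) ?I"
    using brownian st by (simp add: standard_brownian_motion_def)
  have "indep_set (sets (natural_filtration Q W s) \<union> null_sets Q) ?I"
  proof (rule indep_setI)
    show "sets (natural_filtration Q W s) \<union> null_sets Q \<subseteq> events" using sets_natural_subset by auto
    show I: "?I \<subseteq> events" by (rule indep_setD_ev2[OF ind])
    fix A B assume A: "A \<in> sets (natural_filtration Q W s) \<union> null_sets Q" and B: "B \<in> ?I"
    show "prob (A \<inter> B) = prob A * prob B"
    proof (cases "A \<in> null_sets Q")
      case True
      then have "A \<inter> B \<in> null_sets Q" using complete2 by (metis inf_le1)
      with True show ?thesis by (simp add: measure_def null_setsD1)
    next
      case False
      then show ?thesis using A B indep_setD[OF ind] by auto
    qed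
  qed
  moreover have "Int_stable (sets (natural_filtration Q W s) \<union> null_sets Q)"
    unfolding Int_stable_def using complete2 by (metis Un_iff inf_le1 inf_le2 sets.Int)
  moreover have "Int_stable ?I"
  proof (rule Int_stableI)
    fix a b assume "a \<in> ?I" "b \<in> ?I"
    then obtain A B where AB: "A \<in> sets borel" "B \<in> sets borel"
      "a = (\<lambda>\<omega>. W t \<omega> - W s \<omega>) -` A \<inter> space Q" "b = (\<lambda>\<omega>. W t \<omega> - W s \<omega>) -` B \<inter> space Q" by auto
    then have "a \<inter> b = (\<lambda>\<omega>. W t \<omega> - W s \<omega>) -` (A \<inter> B) \<inter> space Q" by auto
    moreover have "A \<inter> B \<in> sets borel" using AB by auto
    ultimately show "a \<inter> b \<in> ?I" by blast
  qed
  ultimately show ?thesis unfolding sets_F by (rule indep_set_sigma_sets)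
qed

lemma indep_var_F_increment:
  fixes M :: "'a \<Rightarrow> real"
  assumes st: "0 \<le> s" "s < t" and M: "M \<in> borel_measurable (F s)"
  shows "indep_var borel M borel (\<lambda>\<omega>. W t \<omega> - W s \<omega>)"
  unfolding indep_var_eq
proof (intro conjI)
  show "random_variable borel M" using M by (rule measurable_F_imp_Q)
  show "random_variable borel (\<lambda>\<omega>. W t \<omega> - W s \<omega>)" using st W_measurable[of s] W_measurable[of t] by simp
  let ?S = "sigma_sets (space Q) {M -` A \<inter> space Q | A. A \<in> sets borel}"
  have S: "?S \<subseteq> sets (F s)"
    using measurable_sets[OF M] sets.sigma_sets_subset[of "{M -` A \<inter> space Q | A. A \<in> sets borel}" "F s"]
    by auto
  note ind = indep_set_F_increment[OF st]
  show "indep_set ?S (sigma_sets (space Q) {(\<lambda>\<omega>. W t \<omega> - W s \<omega>) -` A \<inter> space Q | A. A \<in> sets borel})"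
    using S indep_setD[OF ind] indep_setD_ev1[OF ind] indep_setD_ev2[OF ind]
    by (intro indep_setI) auto
qed

lemma increment_distributed:
  assumes st: "0 \<le> s" "s < t"
  shows "distributed Q lborel (\<lambda>\<omega>. W t \<omega> - W s \<omega>) (normal_density 0 (sqrt (t - s)))"
  using brownian st by (simp add: standard_brownian_motion_def)

lemma increment_moments:
  assumes st: "0 \<le> s" "s < t"
  shows "integrable Q (\<lambda>\<omega>. W t \<omega> - W s \<omega>)" "expectation (\<lambda>\<omega>. W t \<omega> - W s \<omega>) = 0"
    "integrable Q (\<lambda>\<omega>. (W t \<omega> - W s \<omega>)\<^sup>2)" "expectation (\<lambda>\<omega>. (W t \<omega> - W s \<omega>)\<^sup>2) = t - s"
proof -
  note D = increment_distributed[OF st]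
  have sg: "0 < sqrt (t - s)" using st by simp
  show "integrable Q (\<lambda>\<omega>. W t \<omega> - W s \<omega>)"
    using distributed_integrable[OF D, of "\<lambda>x. x"] integrable_normal_moment_nz_1[OF sg, of 0] by simp
  show E: "expectation (\<lambda>\<omega>. W t \<omega> - W s \<omega>) = 0"
    using normal_distributed_expectation[OF sg D] .
  show "integrable Q (\<lambda>\<omega>. (W t \<omega> - W s \<omega>)\<^sup>2)"
    using distributed_integrable[OF D, of "\<lambda>x. x\<^sup>2"] integrable_normal_moment[OF sg, of 0 2] by simp
  show "expectation (\<lambda>\<omega>. (W t \<omega> - W s \<omega>)\<^sup>2) = t - s"
    using normal_distributed_variance[OF sg D] st unfolding E by simp
qed

lemma increment_mgf:
  assumes st: "0 \<le> s" "s < t"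
  shows "integrable Q (\<lambda>\<omega>. exp (c * (W t \<omega> - W s \<omega>)))"
    "expectation (\<lambda>\<omega>. exp (c * (W t \<omega> - W s \<omega>))) = exp (c\<^sup>2 * (t - s) / 2)"
proof -
  note D = increment_distributed[OF st]
  have sg: "0 < sqrt (t - s)" using st by simp
  have eq: "normal_density 0 (sqrt (t - s)) x * exp (c * x) =
      exp (c\<^sup>2 * (t - s) / 2) * normal_density (c * (t - s)) (sqrt (t - s)) x" for x
  proof -
    have "- (x\<^sup>2) / (2 * (t - s)) + c * x = c\<^sup>2 * (t - s) / 2 + - (x - c * (t - s))\<^sup>2 / (2 * (t - s))"
      using st by (simp add: field_simps power2_eq_square)
    then show ?thesis using st by (simp add: normal_density_def flip: exp_add)
  qed
  show "integrable Q (\<lambda>\<omega>. exp (c * (W t \<omega> - W s \<omega>)))"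
    using distributed_integrable[OF D, of "\<lambda>x. exp (c * x)"] sg by (simp add: eq)
  show "expectation (\<lambda>\<omega>. exp (c * (W t \<omega> - W s \<omega>))) = exp (c\<^sup>2 * (t - s) / 2)"
    using distributed_integral[OF D, of "\<lambda>x. exp (c * x)"] sg by (simp add: eq)
qed

text \<open>
  One step of the exponential martingale. The case \<open>s = t\<close> is included so that partitions with
  repeated points need no special treatment.
\<close>

lemma exp_increment_step:
  assumes st: "0 \<le> s" "s \<le> t" and M: "M \<in> borel_measurable (F s)" "integrable Q M"
  shows "integrable Q (\<lambda>\<omega>. M \<omega> * exp (c * (W t \<omega> - W s \<omega>)))"
    "expectation (\<lambda>\<omega>. M \<omega> * exp (c * (W t \<omega> - W s \<omega>))) = expectation M * exp (c\<^sup>2 * (t - s) / 2)"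
proof -
  have "integrable Q (\<lambda>\<omega>. M \<omega> * exp (c * (W t \<omega> - W s \<omega>))) \<and>
    expectation (\<lambda>\<omega>. M \<omega> * exp (c * (W t \<omega> - W s \<omega>))) = expectation M * exp (c\<^sup>2 * (t - s) / 2)"
  proof (cases "s = t")
    case False
    then have st: "0 \<le> s" "s < t" using st by auto
    have "indep_var borel M borel (\<lambda>\<omega>. exp (c * (W t \<omega> - W s \<omega>)))"
      using indep_var_compose[OF indep_var_F_increment[OF st M(1)], of "\<lambda>x. x" borel "\<lambda>x. exp (c * x)" borel]
      by (simp add: comp_def)
    then show ?thesis
      using indep_var_integrable[OF _ M(2) increment_mgf(1)[OF st]]
        indep_var_lebesgue_integral[OF _ M(2) increment_mgf(1)[OF st]] increment_mgf(2)[OF st]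
      by simp
  qed (use M in simp)
  then show "integrable Q (\<lambda>\<omega>. M \<omega> * exp (c * (W t \<omega> - W s \<omega>)))"
    "expectation (\<lambda>\<omega>. M \<omega> * exp (c * (W t \<omega> - W s \<omega>))) = expectation M * exp (c\<^sup>2 * (t - s) / 2)"
    by auto
qed

text \<open>
  One step of the Ito isometry: the cross term vanishes since the increment is centred and
  independent of \<open>M * h\<close>.
\<close>

lemma square_increment_step:
  assumes st: "0 \<le> s" "s \<le> t" and M: "M \<in> borel_measurable (F s)" "integrable Q (\<lambda>\<omega>. (M \<omega>)\<^sup>2)"
    and h: "h \<in> borel_measurable (F s)" "\<And>\<omega>. \<omega> \<in> space Q \<Longrightarrow> \<bar>h \<omega>\<bar> \<le> c"
  shows "integrable Q (\<lambda>\<omega>. (M \<omega> + h \<omega> * (W t \<omega> - W s \<omega>))\<^sup>2)"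
    "expectation (\<lambda>\<omega>. (M \<omega> + h \<omega> * (W t \<omega> - W s \<omega>))\<^sup>2) =
       expectation (\<lambda>\<omega>. (M \<omega>)\<^sup>2) + expectation (\<lambda>\<omega>. (h \<omega>)\<^sup>2) * (t - s)"
proof -
  have "integrable Q (\<lambda>\<omega>. (M \<omega> + h \<omega> * (W t \<omega> - W s \<omega>))\<^sup>2) \<and>
    expectation (\<lambda>\<omega>. (M \<omega> + h \<omega> * (W t \<omega> - W s \<omega>))\<^sup>2) =
       expectation (\<lambda>\<omega>. (M \<omega>)\<^sup>2) + expectation (\<lambda>\<omega>. (h \<omega>)\<^sup>2) * (t - s)"
  proof (cases "s = t")
    case False
    then have st: "0 \<le> s" "s < t" using st by auto
    have [measurable]: "M \<in> borel_measurable Q" "h \<in> borel_measurable Q"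
      using M h by (auto intro: measurable_F_imp_Q)
    let ?X = "\<lambda>\<omega>. W t \<omega> - W s \<omega>"
    have hc: "\<bar>h \<omega>\<bar> \<le> \<bar>c\<bar>" if "\<omega> \<in> space Q" for \<omega> using h(2)[OF that] by simp
    have iM: "integrable Q M" by (rule square_integrable_imp_integrable[OF _ M(2)]) simp
    have iMh: "integrable Q (\<lambda>\<omega>. 2 * M \<omega> * h \<omega>)"
    proof (rule Bochner_Integration.integrable_bound)
      show "integrable Q (\<lambda>\<omega>. 2 * c * M \<omega>)" using iM by simp
      show "AE \<omega> in Q. norm (2 * M \<omega> * h \<omega>) \<le> norm (2 * c * M \<omega>)"
      proof (rule AE_I2)
        fix \<omega> assume "\<omega> \<in> space Q"
        then have "\<bar>M \<omega>\<bar> * \<bar>h \<omega>\<bar> \<le> \<bar>M \<omega>\<bar> * \<bar>c\<bar>" by (intro mult_left_mono hc) auto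
        then show "norm (2 * M \<omega> * h \<omega>) \<le> norm (2 * c * M \<omega>)" by (simp add: abs_mult mult.commute)
      qed
    qed simp
    have ih: "integrable Q (\<lambda>\<omega>. (h \<omega>)\<^sup>2)"
    proof (rule integrable_const_bound[of _ "c\<^sup>2"])
      show "AE \<omega> in Q. norm ((h \<omega>)\<^sup>2) \<le> c\<^sup>2"
        using hc by (auto simp: abs_le_square_iff)
    qed simp
    have "(\<lambda>\<omega>. 2 * M \<omega> * h \<omega>) \<in> borel_measurable (F s)" using M h by measurable
    note i1 = indep_var_F_increment[OF st this]
    have "(\<lambda>\<omega>. (h \<omega>)\<^sup>2) \<in> borel_measurable (F s)" using h by measurable
    note indep_var_compose[OF indep_var_F_increment[OF st this], of "\<lambda>x. x" borel "\<lambda>x. x\<^sup>2" borel]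
    then have i2: "indep_var borel (\<lambda>\<omega>. (h \<omega>)\<^sup>2) borel (\<lambda>\<omega>. (?X \<omega>)\<^sup>2)" by (simp add: comp_def)
    note mom = increment_moments[OF st]
    have e1: "integrable Q (\<lambda>\<omega>. 2 * M \<omega> * h \<omega> * ?X \<omega>)" "expectation (\<lambda>\<omega>. 2 * M \<omega> * h \<omega> * ?X \<omega>) = 0"
      using indep_var_integrable[OF i1 iMh mom(1)] indep_var_lebesgue_integral[OF i1 iMh mom(1)] mom(2)
      by auto
    have e2: "integrable Q (\<lambda>\<omega>. (h \<omega>)\<^sup>2 * (?X \<omega>)\<^sup>2)"
       "expectation (\<lambda>\<omega>. (h \<omega>)\<^sup>2 * (?X \<omega>)\<^sup>2) = expectation (\<lambda>\<omega>. (h \<omega>)\<^sup>2) * (t - s)"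
      using indep_var_integrable[OF i2 ih mom(3)] indep_var_lebesgue_integral[OF i2 ih mom(3)] mom(4)
      by auto
    have "(\<lambda>\<omega>. (M \<omega> + h \<omega> * ?X \<omega>)\<^sup>2) =
        (\<lambda>\<omega>. (M \<omega>)\<^sup>2 + 2 * M \<omega> * h \<omega> * ?X \<omega> + (h \<omega>)\<^sup>2 * (?X \<omega>)\<^sup>2)"
      by (simp add: fun_eq_iff power2_eq_square algebra_simps)
    then show ?thesis using M(2) e1 e2 by simp
  qed (use M in simp)
  then show "integrable Q (\<lambda>\<omega>. (M \<omega> + h \<omega> * (W t \<omega> - W s \<omega>))\<^sup>2)"
    "expectation (\<lambda>\<omega>. (M \<omega> + h \<omega> * (W t \<omega> - W s \<omega>))\<^sup>2) =
       expectation (\<lambda>\<omega>. (M \<omega>)\<^sup>2) + expectation (\<lambda>\<omega>. (h \<omega>)\<^sup>2) * (t - s)"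
    by auto
qed

end

section \<open>The Ito integral of a continuously differentiable function\<close>

lemma nn_integral_Icc:
  fixes g :: "real \<Rightarrow> real"
  assumes g: "continuous_on {a..b} g" and nn: "\<And>s. s \<in> {a..b} \<Longrightarrow> 0 \<le> g s"
  shows "(\<lambda>s. ennreal (g s) * indicator {a..b} s) \<in> borel_measurable lborel"
    "(\<integral>\<^sup>+s\<in>{a..b}. ennreal (g s) \<partial>lborel) = ennreal (integral {a..b} g)"
proof -
  have eq: "ennreal (g s) * indicator {a..b} s = ennreal (indicator {a..b} s *\<^sub>R g s)" for s
    by (auto simp: indicator_def)
  have i: "set_integrable lborel {a..b} g" by (rule borel_integrable_atLeastAtMost'[OF g])
  then have i': "integrable lborel (\<lambda>s. indicator {a..b} s *\<^sub>R g s)" by (simp add: set_integrable_def)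
  show "(\<lambda>s. ennreal (g s) * indicator {a..b} s) \<in> borel_measurable lborel"
    unfolding eq using borel_measurable_integrable[OF i'] by simp
  have "(\<integral>\<^sup>+s\<in>{a..b}. ennreal (g s) \<partial>lborel) = ennreal (LBINT s:{a..b}. g s)"
    unfolding eq set_lebesgue_integral_def
    by (rule nn_integral_eq_integral[OF i']) (auto simp: indicator_def nn)
  then show "(\<integral>\<^sup>+s\<in>{a..b}. ennreal (g s) \<partial>lborel) = ennreal (integral {a..b} g)"
    using set_borel_integral_eq_integral(2)[OF i] by simp
qed

lemma nn_integral_Ioc:
  fixes g :: "real \<Rightarrow> real"
  assumes g: "continuous_on {a..b} g" and nn: "\<And>s. s \<in> {a..b} \<Longrightarrow> 0 \<le> g s"
  shows "(\<lambda>s. ennreal (g s) * indicator {a<..b} s) \<in> borel_measurable lborel"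
    "(\<integral>\<^sup>+s\<in>{a<..b}. ennreal (g s) \<partial>lborel) = ennreal (integral {a..b} g)"
proof -
  have [measurable]: "(\<lambda>s. ennreal (g s) * indicator {a..b} s) \<in> borel_measurable borel"
    using nn_integral_Icc(1)[OF assms] by simp
  have "(\<lambda>s. (ennreal (g s) * indicator {a..b} s) * indicator {a<..b} s) \<in> borel_measurable lborel"
    by measurable
  also have "(\<lambda>s. (ennreal (g s) * indicator {a..b} s) * indicator {a<..b} s) =
      (\<lambda>s. ennreal (g s) * indicator {a<..b} s)" by (auto simp: indicator_def)
  finally show "(\<lambda>s. ennreal (g s) * indicator {a<..b} s) \<in> borel_measurable lborel" .
  have "(\<integral>\<^sup>+s\<in>{a<..b}. ennreal (g s) \<partial>lborel) = (\<integral>\<^sup>+s\<in>{a..b}. ennreal (g s) \<partial>lborel)"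
    using AE_lborel_singleton[of a]
    by (intro nn_integral_cong_AE, eventually_elim) (auto simp: indicator_def)
  then show "(\<integral>\<^sup>+s\<in>{a<..b}. ennreal (g s) \<partial>lborel) = ennreal (integral {a..b} g)"
    using nn_integral_Icc(2)[OF assms] by simp
qed

lemma simple_integrand_mono:
  assumes "simple_integrand Q F t n ts \<xi>" "i \<le> j" "j \<le> n"
  shows "ts i \<le> ts j"
  using assms(2,3)
proof (induction j rule: dec_induct)
  case (step j)
  then show ?case using assms(1) by (auto simp: simple_integrand_def intro: order_trans)
qed simp

lemma simple_integrand_in:
  assumes "simple_integrand Q F t n ts \<xi>" "i \<le> n"
  shows "ts i \<in> {0..t}"
  using simple_integrand_mono[OF assms(1), of 0 i] simple_integrand_mono[OF assms(1), of i n] assms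
  by (auto simp: simple_integrand_def)

lemma simple_integrand_coefficient:
  assumes "simple_integrand Q F t n ts \<xi>" "i < n"
  shows "\<xi> i \<in> borel_measurable (F (ts i))" "\<exists>c. \<forall>\<omega>\<in>space Q. \<bar>\<xi> i \<omega>\<bar> \<le> c"
  using assms unfolding simple_integrand_def by blast+

lemma simple_process_on_interval:
  assumes si: "simple_integrand Q F t n ts \<xi>" and i: "i < n" and s: "s \<in> {ts i<..ts (Suc i)}"
  shows "simple_process n ts \<xi> s \<omega> = \<xi> i \<omega>"
proof -
  have "\<xi> j \<omega> * indicator {ts j<..ts (Suc j)} s = 0" if "j < n" "j \<noteq> i" for j
  proof (cases "j < i")
    case True
    then have "ts (Suc j) \<le> ts i" using i by (intro simple_integrand_mono[OF si]) auto
    then show ?thesis using s by auto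
  next
    case False
    then have "ts (Suc i) \<le> ts j" using that by (intro simple_integrand_mono[OF si]) auto
    then show ?thesis using s by auto
  qed
  then have "simple_process n ts \<xi> s \<omega> = (\<Sum>j<n. if j = i then \<xi> i \<omega> else 0)"
    unfolding simple_process_def using s by (intro sum.cong) auto
  then show ?thesis using i by simp
qed

lemma nn_integral_simple_process_error:
  assumes si: "simple_integrand Q F t n ts \<xi>" and f: "continuous_on {0..t} f"
  shows "(\<Sum>i<n. ennreal (integral {ts i..ts (Suc i)} (\<lambda>s. (\<xi> i \<omega> - f s)\<^sup>2)))
     \<le> (\<integral>\<^sup>+s\<in>{0..t}. ennreal ((simple_process n ts \<xi> s \<omega> - f s)\<^sup>2) \<partial>lborel)"
proof -
  have cont: "continuous_on {ts i..ts (Suc i)} (\<lambda>s. (\<xi> i \<omega> - f s)\<^sup>2)" if "i < n" for i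
    using simple_integrand_in[OF si, of i] simple_integrand_in[OF si, of "Suc i"] that
    by (intro continuous_intros continuous_on_subset[OF f]) auto
  have "(\<Sum>i<n. ennreal (integral {ts i..ts (Suc i)} (\<lambda>s. (\<xi> i \<omega> - f s)\<^sup>2))) =
      (\<Sum>i<n. \<integral>\<^sup>+s\<in>{ts i<..ts (Suc i)}. ennreal ((\<xi> i \<omega> - f s)\<^sup>2) \<partial>lborel)"
    by (intro sum.cong refl nn_integral_Ioc(2)[symmetric] cont) auto
  also have "\<dots> = (\<integral>\<^sup>+s. (\<Sum>i<n. ennreal ((\<xi> i \<omega> - f s)\<^sup>2) * indicator {ts i<..ts (Suc i)} s) \<partial>lborel)"
    by (intro nn_integral_sum[symmetric] nn_integral_Ioc(1) cont) auto
  also have "\<dots> = (\<integral>\<^sup>+s. (\<Sum>i<n. ennreal ((simple_process n ts \<xi> s \<omega> - f s)\<^sup>2) * indicator {ts i<..ts (Suc i)} s) \<partial>lborel)"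
    using simple_process_on_interval[OF si] by (intro nn_integral_cong sum.cong) (auto simp: indicator_def)
  also have "\<dots> \<le> (\<integral>\<^sup>+s\<in>{0..t}. ennreal ((simple_process n ts \<xi> s \<omega> - f s)\<^sup>2) \<partial>lborel)"
  proof (rule nn_integral_mono)
    fix s
    have "(\<Sum>i<k. indicator {ts i<..ts (Suc i)} s) = (indicator {0<..ts k} s :: ennreal)" if "k \<le> n" for k
      using that
    proof (induction k)
      case 0 then show ?case using si by (simp add: simple_integrand_def)
    next
      case (Suc k)
      moreover have "ts k \<le> ts (Suc k)" "0 \<le> ts k"
        using Suc.prems simple_integrand_mono[OF si, of k "Suc k"] simple_integrand_in[OF si, of k] by auto
      ultimately show ?case by (auto simp: indicator_def)
    qed
    from this[of n] have "(\<Sum>i<n. indicator {ts i<..ts (Suc i)} s) \<le> (indicator {0..t} s :: ennreal)"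
      using si by (auto simp: simple_integrand_def indicator_def)
    then show "(\<Sum>i<n. ennreal ((simple_process n ts \<xi> s \<omega> - f s)\<^sup>2) * indicator {ts i<..ts (Suc i)} s)
        \<le> ennreal ((simple_process n ts \<xi> s \<omega> - f s)\<^sup>2) * indicator {0..t} s"
      unfolding sum_distrib_left[symmetric] by (rule mult_left_mono) simp
  qed
  finally show ?thesis .
qed

context augmented_brownian_motion
begin

abbreviation wiener :: "(real \<Rightarrow> real) \<Rightarrow> (real \<Rightarrow> real) \<Rightarrow> real \<Rightarrow> real \<Rightarrow> 'a \<Rightarrow> real" where
  "wiener f f' u v \<omega> \<equiv> parts_integral f f' (\<lambda>s. W s \<omega>) u v"

text \<open>
  Convergence almost surely, rather than only in mean square, makes \<open>wiener\<close> adapted and lets moments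
  of the sums be passed to the limit by Fatou's lemma.
\<close>

lemma AE_riemann_sums_wiener:
  assumes "C1_on u v f f'" "0 \<le> u" "u \<le> v"
  shows "AE \<omega> in Q. (\<lambda>n. \<Sum>k<Suc n. f (grid u v (Suc n) k) *
            (W (grid u v (Suc n) (Suc k)) \<omega> - W (grid u v (Suc n) k) \<omega>))
          \<longlonglongrightarrow> wiener f f' u v \<omega>"
  using AE_W_continuous
proof eventually_elim
  case (elim \<omega>)
  then have "continuous_on {u..v} (\<lambda>t. W t \<omega>)"
    by (rule continuous_on_subset) (use assms in auto)
  from riemann_sums_tendsto_parts_integral[OF assms(1,3) this] show ?case .
qed

lemma weighted_increments_measurable_F:
  assumes "0 \<le> u" "u \<le> v" "k \<le> N" "M \<in> borel_measurable (F u)"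
    and "\<And>j. j < k \<Longrightarrow> h j \<in> borel_measurable (F u)"
  shows "(\<lambda>\<omega>. M \<omega> + (\<Sum>j<k. h j \<omega> * (W (grid u v N (Suc j)) \<omega> - W (grid u v N j) \<omega>)))
    \<in> borel_measurable (F (grid u v N k))"
proof -
  have ge: "u \<le> grid u v N j" for j using grid_mono[OF assms(2), of 0 j N] by simp
  have [measurable]: "W (grid u v N j) \<in> borel_measurable (F (grid u v N k))" if "j \<le> k" for j
    using that grid_mono[OF assms(2)] ge[of j] assms(1) by (intro W_measurable_F) auto
  have [measurable]: "h j \<in> borel_measurable (F (grid u v N k))" if "j < k" for j
    using that by (rule measurable_F_mono[OF assms(5) ge])
  have [measurable]: "M \<in> borel_measurable (F (grid u v N k))" by (rule measurable_F_mono[OF assms(4) ge])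
  show ?thesis by (intro borel_measurable_add borel_measurable_sum borel_measurable_times borel_measurable_diff) auto
qed

lemma wiener_measurable_F:
  assumes C1: "C1_on u v f f'" and uv: "0 \<le> u" "u \<le> v"
  shows "wiener f f' u v \<in> borel_measurable (F v)"
proof -
  let ?S = "\<lambda>n \<omega>. \<Sum>k<Suc n. f (grid u v (Suc n) k) *
            (W (grid u v (Suc n) (Suc k)) \<omega> - W (grid u v (Suc n) k) \<omega>)"
  have "?S n \<in> borel_measurable (F v)" for n
    using weighted_increments_measurable_F[OF uv, of "Suc n" "Suc n" "\<lambda>_. 0" "\<lambda>j _. f (grid u v (Suc n) j)"]
    by simp
  then have "(\<lambda>\<omega>. lim (\<lambda>n. ?S n \<omega>)) \<in> borel_measurable (F v)"
    by (rule borel_measurable_lim_metric)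
  moreover have "AE \<omega> in Q. lim (\<lambda>n. ?S n \<omega>) = wiener f f' u v \<omega>"
    using AE_riemann_sums_wiener[OF assms] by eventually_elim (rule limI)
  ultimately show ?thesis by (rule measurable_F_AE_cong)
qed

lemma square_weighted_increments:
  assumes uv: "0 \<le> u" "u \<le> v" and N: "N > 0"
    and M: "M \<in> borel_measurable (F u)" "integrable Q (\<lambda>\<omega>. (M \<omega>)\<^sup>2)"
    and h: "h \<in> borel_measurable (F u)" "\<And>\<omega>. \<omega> \<in> space Q \<Longrightarrow> \<bar>h \<omega>\<bar> \<le> c"
    and k: "k \<le> N"
  shows "integrable Q (\<lambda>\<omega>. (M \<omega> + (\<Sum>j<k. (h \<omega> - f (grid u v N j)) *
            (W (grid u v N (Suc j)) \<omega> - W (grid u v N j) \<omega>)))\<^sup>2) \<and>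
    expectation (\<lambda>\<omega>. (M \<omega> + (\<Sum>j<k. (h \<omega> - f (grid u v N j)) *
            (W (grid u v N (Suc j)) \<omega> - W (grid u v N j) \<omega>)))\<^sup>2) =
      expectation (\<lambda>\<omega>. (M \<omega>)\<^sup>2) +
      (\<Sum>j<k. expectation (\<lambda>\<omega>. (h \<omega> - f (grid u v N j))\<^sup>2) * ((v - u) / real N))"
  using k
proof (induction k)
  case 0 show ?case using M by simp
next
  case (Suc k)
  let ?x = "grid u v N k" and ?y = "grid u v N (Suc k)"
  let ?P = "\<lambda>\<omega>. M \<omega> + (\<Sum>j<k. (h \<omega> - f (grid u v N j)) *
            (W (grid u v N (Suc j)) \<omega> - W (grid u v N j) \<omega>))"
  have ge: "u \<le> ?x" using grid_mono[OF uv(2), of 0 k N] by simp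
  have xy: "0 \<le> ?x" "?x \<le> ?y" using ge uv grid_mono[OF uv(2), of k "Suc k" N] by auto
  have m: "?P \<in> borel_measurable (F ?x)"
    using h(1) Suc.prems by (intro weighted_increments_measurable_F uv M) auto
  have "h \<in> borel_measurable (F ?x)" by (rule measurable_F_mono[OF h(1) ge])
  then have hm: "(\<lambda>\<omega>. h \<omega> - f ?x) \<in> borel_measurable (F ?x)" by simp
  have hb: "\<bar>h \<omega> - f ?x\<bar> \<le> c + \<bar>f ?x\<bar>" if "\<omega> \<in> space Q" for \<omega> using h(2)[OF that] by linarith
  have IH: "integrable Q (\<lambda>\<omega>. (?P \<omega>)\<^sup>2)" using Suc by simp
  note st = square_increment_step[OF xy m IH hm hb]
  have "M \<omega> + (\<Sum>j<Suc k. (h \<omega> - f (grid u v N j)) *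
            (W (grid u v N (Suc j)) \<omega> - W (grid u v N j) \<omega>)) =
      ?P \<omega> + (h \<omega> - f ?x) * (W ?y \<omega> - W ?x \<omega>)" for \<omega> by simp
  then show ?case using st Suc by (simp only: grid_step sum.lessThan_Suc) simp
qed

text \<open>
  The increment of a simple integral with coefficient \<open>h\<close> is compared directly with the path integral
  of \<open>f\<close> over the same interval: refining the interval, their difference is a limit of sums with
  coefficients \<open>h - f\<close>, and the isometry for these sums survives as an inequality by Fatou's lemma. Comparing
  with \<open>f\<close> itself makes common refinements of two simple processes unnecessary.
\<close>

lemma ito_step_inequality:
  assumes C1: "C1_on u v f f'" and uv: "0 \<le> u" "u \<le> v"
    and M: "M \<in> borel_measurable (F u)" "integrable Q (\<lambda>\<omega>. (M \<omega>)\<^sup>2)"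
    and h: "h \<in> borel_measurable (F u)" "\<And>\<omega>. \<omega> \<in> space Q \<Longrightarrow> \<bar>h \<omega>\<bar> \<le> c"
  shows "integrable Q (\<lambda>\<omega>. (M \<omega> + h \<omega> * (W v \<omega> - W u \<omega>) - wiener f f' u v \<omega>)\<^sup>2)"
    "integrable Q (\<lambda>\<omega>. integral {u..v} (\<lambda>s. (h \<omega> - f s)\<^sup>2))"
    "expectation (\<lambda>\<omega>. (M \<omega> + h \<omega> * (W v \<omega> - W u \<omega>) - wiener f f' u v \<omega>)\<^sup>2) \<le>
      expectation (\<lambda>\<omega>. (M \<omega>)\<^sup>2) + expectation (\<lambda>\<omega>. integral {u..v} (\<lambda>s. (h \<omega> - f s)\<^sup>2))"
proof -
  have [measurable]: "h \<in> borel_measurable Q" "M \<in> borel_measurable Q"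
    using h M by (auto intro: measurable_F_imp_Q)
  have wm [measurable]: "wiener f f' u v \<in> borel_measurable Q"
    using wiener_measurable_F[OF C1 uv] by (rule measurable_F_imp_Q)
  have [measurable]: "W u \<in> borel_measurable Q" "W v \<in> borel_measurable Q" using uv by auto
  have cf: "continuous_on {u..v} f" by (rule C1_on_continuous[OF C1])
  have ih: "integrable Q h" by (rule integrable_const_bound[of _ c]) (use h(2) in auto)
  have ih2: "integrable Q (\<lambda>\<omega>. (h \<omega>)\<^sup>2)"
  proof (rule integrable_const_bound[of _ "c\<^sup>2"])
    have "\<bar>h \<omega>\<bar> \<le> \<bar>c\<bar>" if "\<omega> \<in> space Q" for \<omega> using h(2)[OF that] by simp
    then show "AE \<omega> in Q. norm ((h \<omega>)\<^sup>2) \<le> c\<^sup>2"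
      by (auto simp: abs_le_square_iff)
  qed simp
  have int: "integral {u..v} (\<lambda>s. (x - f s)\<^sup>2) =
      x\<^sup>2 * (v - u) - 2 * x * integral {u..v} f + integral {u..v} (\<lambda>s. (f s)\<^sup>2)" for x
  proof -
    have "((\<lambda>s. x\<^sup>2 - 2 * x * f s + (f s)\<^sup>2) has_integral
        (x\<^sup>2 * (v - u) - 2 * x * integral {u..v} f + integral {u..v} (\<lambda>s. (f s)\<^sup>2))) {u..v}"
      using has_integral_const_real[of "x\<^sup>2" u v] uv
      by (intro has_integral_add has_integral_diff has_integral_mult_right integrable_integral
          integrable_continuous_interval continuous_intros cf) (simp add: mult.commute)
    then show ?thesis by (simp add: integral_unique power2_diff algebra_simps)
  qed
  show i: "integrable Q (\<lambda>\<omega>. integral {u..v} (\<lambda>s. (h \<omega> - f s)\<^sup>2))"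
    unfolding int using ih ih2 by simp
  let ?X = "\<lambda>n \<omega>. (M \<omega> + (\<Sum>j<Suc n. (h \<omega> - f (grid u v (Suc n) j)) *
            (W (grid u v (Suc n) (Suc j)) \<omega> - W (grid u v (Suc n) j) \<omega>)))\<^sup>2"
  let ?X' = "\<lambda>\<omega>. (M \<omega> + h \<omega> * (W v \<omega> - W u \<omega>) - wiener f f' u v \<omega>)\<^sup>2"
  define R where "R = expectation (\<lambda>\<omega>. (M \<omega>)\<^sup>2) + expectation (\<lambda>\<omega>. integral {u..v} (\<lambda>s. (h \<omega> - f s)\<^sup>2))"
  have iX: "integrable Q (?X n)" for n
    using square_weighted_increments[OF uv _ M h, of "Suc n" "Suc n" f] by blast
  have eX: "expectation (?X n) = expectation (\<lambda>\<omega>. (M \<omega>)\<^sup>2) +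
      (expectation (\<lambda>\<omega>. (h \<omega>)\<^sup>2) * (v - u)
       - 2 * expectation h * (\<Sum>j<Suc n. f (grid u v (Suc n) j) * ((v - u) / real (Suc n)))
       + (\<Sum>j<Suc n. (f (grid u v (Suc n) j))\<^sup>2 * ((v - u) / real (Suc n))))" for n
  proof -
    have "expectation (\<lambda>\<omega>. (h \<omega> - y)\<^sup>2) = expectation (\<lambda>\<omega>. (h \<omega>)\<^sup>2) - 2 * expectation h * y + y\<^sup>2" for y
      using ih ih2 by (simp add: power2_diff prob_space)
    then have "(\<Sum>j<Suc n. expectation (\<lambda>\<omega>. (h \<omega> - f (grid u v (Suc n) j))\<^sup>2) * ((v - u) / real (Suc n))) =
      (\<Sum>j<Suc n. expectation (\<lambda>\<omega>. (h \<omega>)\<^sup>2) * ((v - u) / real (Suc n)))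
       - 2 * expectation h * (\<Sum>j<Suc n. f (grid u v (Suc n) j) * ((v - u) / real (Suc n)))
       + (\<Sum>j<Suc n. (f (grid u v (Suc n) j))\<^sup>2 * ((v - u) / real (Suc n)))"
      by (simp only: sum_distrib_left sum.distrib[symmetric] sum_subtractf[symmetric])
         (simp add: algebra_simps)
    moreover have "(\<Sum>j<Suc n. expectation (\<lambda>\<omega>. (h \<omega>)\<^sup>2) * ((v - u) / real (Suc n)))
        = expectation (\<lambda>\<omega>. (h \<omega>)\<^sup>2) * (v - u)"
      by (simp del: of_nat_Suc)
    ultimately show ?thesis
      using square_weighted_increments[OF uv _ M h, of "Suc n" "Suc n" f] by simp
  qed
  note C1sq = C1_on_square[OF C1]
  have "(\<lambda>n. expectation (?X n)) \<longlonglongrightarrow> expectation (\<lambda>\<omega>. (M \<omega>)\<^sup>2) +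
      (expectation (\<lambda>\<omega>. (h \<omega>)\<^sup>2) * (v - u) - 2 * expectation h * integral {u..v} f
       + integral {u..v} (\<lambda>s. (f s)\<^sup>2))"
    unfolding eX by (intro tendsto_intros riemann_sums_tendsto_integral[OF C1 uv(2)]
        riemann_sums_tendsto_integral[OF C1sq uv(2)])
  also have "expectation (\<lambda>\<omega>. (M \<omega>)\<^sup>2) +
      (expectation (\<lambda>\<omega>. (h \<omega>)\<^sup>2) * (v - u) - 2 * expectation h * integral {u..v} f
       + integral {u..v} (\<lambda>s. (f s)\<^sup>2)) = R"
    unfolding R_def int using ih ih2 by (simp add: prob_space)
  finally have lim: "(\<lambda>n. expectation (?X n)) \<longlonglongrightarrow> R" .
  have AEl: "AE \<omega> in Q. (\<lambda>n. ?X n \<omega>) \<longlonglongrightarrow> ?X' \<omega>"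
    using AE_riemann_sums_wiener[OF C1 uv]
  proof eventually_elim
    case (elim \<omega>)
    have tele: "(\<Sum>j<Suc n. (W (grid u v (Suc n) (Suc j)) \<omega> - W (grid u v (Suc n) j) \<omega>)) = W v \<omega> - W u \<omega>" for n
      using sum_lessThan_telescope[of "\<lambda>j. W (grid u v (Suc n) j) \<omega>" "Suc n"] by simp
    have "?X n \<omega> = (M \<omega> + (h \<omega> * (W v \<omega> - W u \<omega>) - (\<Sum>j<Suc n. f (grid u v (Suc n) j) *
            (W (grid u v (Suc n) (Suc j)) \<omega> - W (grid u v (Suc n) j) \<omega>))))\<^sup>2" for n
    proof -
      have "(\<Sum>j<N. (x - y j) * d j) = x * (\<Sum>j<N. d j) - (\<Sum>j<N. y j * d j)"
        for x :: real and y d and N :: nat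
        by (simp only: left_diff_distrib sum_subtractf sum_distrib_left)
      then show ?thesis by (simp only: tele)
    qed
    then show ?case by (simp only: add_diff_eq[symmetric]) (intro tendsto_intros elim)
  qed
  have "(\<integral>\<^sup>+\<omega>. ennreal (?X' \<omega>) \<partial>Q) = (\<integral>\<^sup>+\<omega>. liminf (\<lambda>n. ennreal (?X n \<omega>)) \<partial>Q)"
    using AEl by (intro nn_integral_cong_AE, eventually_elim)
      (rule lim_imp_Liminf[symmetric], simp, rule tendsto_ennrealI)
  also have "\<dots> \<le> liminf (\<lambda>n. \<integral>\<^sup>+\<omega>. ennreal (?X n \<omega>) \<partial>Q)"
    using iX by (intro nn_integral_liminf) (auto dest: borel_measurable_integrable)
  also have "\<dots> = liminf (\<lambda>n. ennreal (expectation (?X n)))"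
    by (subst nn_integral_eq_integral[OF iX]) auto
  also have "\<dots> = ennreal R" 
    by (rule lim_imp_Liminf[OF _ tendsto_ennrealI[OF lim]]) simp
  finally have le: "(\<integral>\<^sup>+\<omega>. ennreal (?X' \<omega>) \<partial>Q) \<le> ennreal R" .
  show iX': "integrable Q ?X'"
    using le by (intro integrableI_nonneg) (auto intro: le_less_trans)
  have "R \<ge> 0" unfolding R_def by (intro add_nonneg_nonneg integral_nonneg_AE Henstock_Kurzweil_Integration.integral_nonneg AE_I2)
      (auto intro!: integrable_continuous_interval continuous_intros cf)
  then show "expectation ?X' \<le> expectation (\<lambda>\<omega>. (M \<omega>)\<^sup>2) + expectation (\<lambda>\<omega>. integral {u..v} (\<lambda>s. (h \<omega> - f s)\<^sup>2))"
    using le nn_integral_eq_integral[OF iX'] by (simp add: R_def)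
qed

lemma AE_wiener_combine:
  assumes "C1_on x z f f'" "0 \<le> x" "x \<le> y" "y \<le> z"
  shows "AE \<omega> in Q. wiener f f' x y \<omega> + wiener f f' y z \<omega> = wiener f f' x z \<omega>"
  using AE_W_continuous
proof eventually_elim
  case (elim \<omega>)
  then have "continuous_on {x..z} (\<lambda>t. W t \<omega>)"
    by (rule continuous_on_subset) (use assms in auto)
  then show ?case using assms by (intro parts_integral_combine) (auto simp: C1_on_def)
qed

lemma ito_inequality_partial:
  assumes C1: "C1_on 0 t f f'" and si: "simple_integrand Q F t n ts \<xi>" and k: "k \<le> n"
  shows "integrable Q (\<lambda>\<omega>. (simple_integral W k ts \<xi> \<omega> - wiener f f' 0 (ts k) \<omega>)\<^sup>2) \<and>
    expectation (\<lambda>\<omega>. (simple_integral W k ts \<xi> \<omega> - wiener f f' 0 (ts k) \<omega>)\<^sup>2) \<le>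
      (\<Sum>i<k. expectation (\<lambda>\<omega>. integral {ts i..ts (Suc i)} (\<lambda>s. (\<xi> i \<omega> - f s)\<^sup>2))) \<and>
    simple_integral W k ts \<xi> \<in> borel_measurable (F (ts k))"
  using k
proof (induction k)
  case 0
  have "ts 0 = 0" using si by (simp add: simple_integrand_def)
  then show ?case by (simp add: simple_integral_def parts_integral_def)
next
  case (Suc k)
  then have IH: "integrable Q (\<lambda>\<omega>. (simple_integral W k ts \<xi> \<omega> - wiener f f' 0 (ts k) \<omega>)\<^sup>2)"
    "expectation (\<lambda>\<omega>. (simple_integral W k ts \<xi> \<omega> - wiener f f' 0 (ts k) \<omega>)\<^sup>2) \<le>
      (\<Sum>i<k. expectation (\<lambda>\<omega>. integral {ts i..ts (Suc i)} (\<lambda>s. (\<xi> i \<omega> - f s)\<^sup>2)))"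
    "simple_integral W k ts \<xi> \<in> borel_measurable (F (ts k))" by auto
  have x: "0 \<le> ts k" "ts k \<le> ts (Suc k)" "ts (Suc k) \<le> t"
    using Suc.prems simple_integrand_mono[OF si, of k "Suc k"] simple_integrand_in[OF si, of k]
      simple_integrand_in[OF si, of "Suc k"] by auto
  obtain c where xi: "\<xi> k \<in> borel_measurable (F (ts k))" "\<And>\<omega>. \<omega> \<in> space Q \<Longrightarrow> \<bar>\<xi> k \<omega>\<bar> \<le> c"
    using simple_integrand_coefficient[OF si, of k] Suc.prems by fastforce
  have C1': "C1_on 0 (ts k) f f'" "C1_on (ts k) (ts (Suc k)) f f'" "C1_on 0 (ts (Suc k)) f f'"
    using x by (auto intro!: C1_on_subset[OF C1])
  have m: "(\<lambda>\<omega>. simple_integral W k ts \<xi> \<omega> - wiener f f' 0 (ts k) \<omega>) \<in> borel_measurable (F (ts k))"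
    using IH(3) wiener_measurable_F[OF C1'(1)] x by (intro borel_measurable_diff) auto
  note st = ito_step_inequality[OF C1'(2) x(1,2) m IH(1) xi]
  have AE: "AE \<omega> in Q. simple_integral W k ts \<xi> \<omega> - wiener f f' 0 (ts k) \<omega> +
      \<xi> k \<omega> * (W (ts (Suc k)) \<omega> - W (ts k) \<omega>) - wiener f f' (ts k) (ts (Suc k)) \<omega> =
      simple_integral W (Suc k) ts \<xi> \<omega> - wiener f f' 0 (ts (Suc k)) \<omega>"
    using AE_wiener_combine[OF C1'(3) _ x(1,2)] by (auto simp: simple_integral_def algebra_simps)
  have m': "simple_integral W (Suc k) ts \<xi> \<in> borel_measurable (F (ts (Suc k)))"
  proof -
    have "simple_integral W (Suc k) ts \<xi> =
       (\<lambda>\<omega>. simple_integral W k ts \<xi> \<omega> + \<xi> k \<omega> * (W (ts (Suc k)) \<omega> - W (ts k) \<omega>))"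
      by (rule ext) (simp add: simple_integral_def)
    also have "\<dots> \<in> borel_measurable (F (ts (Suc k)))"
      using x by (intro borel_measurable_add borel_measurable_times borel_measurable_diff W_measurable_F
          measurable_F_mono[OF IH(3) x(2)] measurable_F_mono[OF xi(1) x(2)]) auto
    finally show ?thesis .
  qed
  have mQ: "(\<lambda>\<omega>. (simple_integral W (Suc k) ts \<xi> \<omega> - wiener f f' 0 (ts (Suc k)) \<omega>)\<^sup>2) \<in> borel_measurable Q"
    using m' wiener_measurable_F[OF C1'(3)] x
    by (intro borel_measurable_power borel_measurable_diff) (auto intro: measurable_F_imp_Q)
  have AE2: "AE \<omega> in Q. (simple_integral W k ts \<xi> \<omega> - wiener f f' 0 (ts k) \<omega> +
      \<xi> k \<omega> * (W (ts (Suc k)) \<omega> - W (ts k) \<omega>) - wiener f f' (ts k) (ts (Suc k)) \<omega>)\<^sup>2 =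
      (simple_integral W (Suc k) ts \<xi> \<omega> - wiener f f' 0 (ts (Suc k)) \<omega>)\<^sup>2"
    using AE by eventually_elim simp
  have mS: "(\<lambda>\<omega>. (simple_integral W k ts \<xi> \<omega> - wiener f f' 0 (ts k) \<omega> +
      \<xi> k \<omega> * (W (ts (Suc k)) \<omega> - W (ts k) \<omega>) - wiener f f' (ts k) (ts (Suc k)) \<omega>)\<^sup>2) \<in> borel_measurable Q"
    using st(1) by (rule borel_measurable_integrable)
  have "integrable Q (\<lambda>\<omega>. (simple_integral W (Suc k) ts \<xi> \<omega> - wiener f f' 0 (ts (Suc k)) \<omega>)\<^sup>2)"
    using integrable_cong_AE[OF mS mQ AE2] st(1) by simp
  moreover have "expectation (\<lambda>\<omega>. (simple_integral W (Suc k) ts \<xi> \<omega> - wiener f f' 0 (ts (Suc k)) \<omega>)\<^sup>2)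
     \<le> (\<Sum>i<Suc k. expectation (\<lambda>\<omega>. integral {ts i..ts (Suc i)} (\<lambda>s. (\<xi> i \<omega> - f s)\<^sup>2)))"
    using integral_cong_AE[OF mS mQ AE2] st(3) IH(2) by simp
  ultimately show ?case using m' by blast
qed

text \<open>
  The mean-square distance of any simple integral to the path integral is bounded by the distance of
  the integrands. This one estimate yields both existence and uniqueness of the Ito integral of
  \<open>f\<close>.
\<close>

lemma ito_inequality:
  assumes C1: "C1_on 0 t f f'" and si: "simple_integrand Q F t n ts \<xi>"
  shows "(\<integral>\<^sup>+\<omega>. ennreal ((simple_integral W n ts \<xi> \<omega> - wiener f f' 0 t \<omega>)\<^sup>2) \<partial>Q) \<le>
    (\<integral>\<^sup>+\<omega>. (\<integral>\<^sup>+s\<in>{0..t}. ennreal ((simple_process n ts \<xi> s \<omega> - f s)\<^sup>2) \<partial>lborel) \<partial>Q)"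
proof -
  have tn: "ts n = t" using si by (simp add: simple_integrand_def)
  have cf: "continuous_on {0..t} f" by (rule C1_on_continuous[OF C1])
  let ?I = "\<lambda>i \<omega>. integral {ts i..ts (Suc i)} (\<lambda>s. (\<xi> i \<omega> - f s)\<^sup>2)"
  have int: "integrable Q (?I i)" and nn: "\<And>\<omega>. 0 \<le> ?I i \<omega>" if i: "i < n" for i
  proof -
    have x: "0 \<le> ts i" "ts i \<le> ts (Suc i)" "{ts i..ts (Suc i)} \<subseteq> {0..t}"
      using i simple_integrand_mono[OF si, of i "Suc i"] simple_integrand_in[OF si, of i]
        simple_integrand_in[OF si, of "Suc i"] by auto
    obtain c where xi: "\<xi> i \<in> borel_measurable (F (ts i))" "\<And>\<omega>. \<omega> \<in> space Q \<Longrightarrow> \<bar>\<xi> i \<omega>\<bar> \<le> c"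
      using simple_integrand_coefficient[OF si, of i] i by fastforce
    show "integrable Q (?I i)"
      using ito_step_inequality(2)[OF C1_on_subset[OF C1 x(3)] x(1,2) _ _ xi, of "\<lambda>_. 0"] by simp
    show "0 \<le> ?I i \<omega>" for \<omega>
      by (intro Henstock_Kurzweil_Integration.integral_nonneg integrable_continuous_interval
          continuous_intros continuous_on_subset[OF cf x(3)]) auto
  qed
  note * = ito_inequality_partial[OF C1 si order_refl, unfolded tn]
  have "(\<integral>\<^sup>+\<omega>. ennreal ((simple_integral W n ts \<xi> \<omega> - wiener f f' 0 t \<omega>)\<^sup>2) \<partial>Q) =
     ennreal (expectation (\<lambda>\<omega>. (simple_integral W n ts \<xi> \<omega> - wiener f f' 0 t \<omega>)\<^sup>2))"
    using * by (intro nn_integral_eq_integral) auto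
  also have "\<dots> \<le> ennreal (\<Sum>i<n. expectation (?I i))"
    using * by (intro ennreal_leI) auto
  also have "\<dots> = (\<Sum>i<n. ennreal (expectation (?I i)))"
    using nn by (intro sum_ennreal[symmetric] integral_nonneg_AE) auto
  also have "\<dots> = (\<Sum>i<n. \<integral>\<^sup>+\<omega>. ennreal (?I i \<omega>) \<partial>Q)"
    using nn int by (intro sum.cong refl nn_integral_eq_integral[symmetric]) auto
  also have "\<dots> = (\<integral>\<^sup>+\<omega>. (\<Sum>i<n. ennreal (?I i \<omega>)) \<partial>Q)"
    using int by (intro nn_integral_sum[symmetric]) (auto dest: borel_measurable_integrable)
  also have "\<dots> \<le> (\<integral>\<^sup>+\<omega>. (\<integral>\<^sup>+s\<in>{0..t}. ennreal ((simple_process n ts \<xi> s \<omega> - f s)\<^sup>2) \<partial>lborel) \<partial>Q)"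
    by (intro nn_integral_mono nn_integral_simple_process_error[OF si cf])
  finally show ?thesis .
qed

lemma progressive_upto_deterministic:
  assumes "continuous_on {0..t} f"
  shows "progressive_upto F t (\<lambda>s _. f s)"
  unfolding progressive_upto_def
proof
  fix u assume u: "u \<in> {0..t}"
  have "f \<in> borel_measurable (restrict_space borel {0..u})"
    using u by (intro borel_measurable_continuous_on_restrict continuous_on_subset[OF assms]) auto
  then show "(\<lambda>(s, \<omega>). f s) \<in> borel_measurable (restrict_space borel {0..u} \<Otimes>\<^sub>M F u)"
    by measurable
qed

lemma simple_integral_measurable:
  assumes si: "simple_integrand Q F t n ts \<xi>"
  shows "simple_integral W n ts \<xi> \<in> borel_measurable Q"
proof -
  have "\<xi> i \<in> borel_measurable Q" "W (ts i) \<in> borel_measurable Q" "W (ts (Suc i)) \<in> borel_measurable Q"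
    if "i < n" for i
    using that simple_integrand_coefficient[OF si, of i] simple_integrand_in[OF si, of i]
      simple_integrand_in[OF si, of "Suc i"] by (auto intro: measurable_F_imp_Q)
  then show ?thesis
    unfolding simple_integral_def[abs_def]
    by (intro borel_measurable_sum borel_measurable_times borel_measurable_diff) auto
qed

text \<open>
  The approximating simple processes freeze \<open>f\<close> at the left end points of equal partitions; the
  Lipschitz bound makes their error of order \<open>1 / n\<close>.
\<close>

lemma has_ito_integral_wiener:
  assumes C1: "C1_on 0 t f f'" and t: "0 \<le> t"
  shows "has_ito_integral Q F W (\<lambda>s _. f s) t (wiener f f' 0 t)"
  unfolding has_ito_integral_def
proof (intro conjI)
  have cf: "continuous_on {0..t} f" by (rule C1_on_continuous[OF C1])
  show "progressive_upto F t (\<lambda>s _. f s)" by (rule progressive_upto_deterministic[OF cf])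
  have "(\<integral>\<^sup>+s\<in>{0..t}. ennreal ((f s)\<^sup>2) \<partial>lborel) = ennreal (integral {0..t} (\<lambda>s. (f s)\<^sup>2))"
    by (intro nn_integral_Icc(2) continuous_intros cf) auto
  then show "(\<integral>\<^sup>+\<omega>. (\<integral>\<^sup>+s\<in>{0..t}. ennreal ((f s)\<^sup>2) \<partial>lborel) \<partial>Q) < \<infinity>"
    by (simp add: emeasure_space_1)
  show "wiener f f' 0 t \<in> borel_measurable (F t)" by (rule wiener_measurable_F[OF C1 order_refl t])
  let ?n = "Suc"
  let ?ts = "\<lambda>k. grid 0 t (Suc k)"
  let ?xi = "\<lambda>k i (\<omega>::'a). f (grid 0 t (Suc k) i)"
  have si: "simple_integrand Q F t (?n k) (?ts k) (?xi k)" for k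
    unfolding simple_integrand_def using t by (auto intro: grid_mono)
  obtain B where B: "B > 0" "\<And>x y. 0 \<le> x \<Longrightarrow> x \<le> y \<Longrightarrow> y \<le> t \<Longrightarrow> \<bar>f y - f x\<bar> \<le> B * (y - x)"
    using C1_on_lipschitz[OF C1] by metis
  have err: "(\<integral>\<^sup>+\<omega>. (\<integral>\<^sup>+s\<in>{0..t}.
            ennreal ((simple_process (?n k) (?ts k) (?xi k) s \<omega> - f s)\<^sup>2) \<partial>lborel) \<partial>Q)
       \<le> ennreal ((B * (t / real (Suc k)))\<^sup>2 * t)" for k
  proof -
    have pt: "(simple_process (?n k) (?ts k) (?xi k) s \<omega> - f s)\<^sup>2 \<le> (B * (t / real (Suc k)))\<^sup>2"
      if s: "s \<in> {0<..t}" for s \<omega>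
    proof -
      \<comment> \<open>The cell of the partition that contains s.\<close>
      define i where "i = (LEAST i. s \<le> grid 0 t (Suc k) (Suc i))"
      have ex: "s \<le> grid 0 t (Suc k) (Suc k)" using s by simp
      have i1: "s \<le> grid 0 t (Suc k) (Suc i)" unfolding i_def by (rule LeastI[of _ k]) (rule ex)
      have ik: "i \<le> k" unfolding i_def by (rule Least_le) (rule ex)
      have i2: "grid 0 t (Suc k) i < s"
      proof (cases i)
        case 0 then show ?thesis using s by simp
      next
        case (Suc j)
        then have "\<not> s \<le> grid 0 t (Suc k) (Suc j)" unfolding i_def by (metis lessI not_less_Least)
        then show ?thesis using Suc by simp
      qed
      have "simple_process (?n k) (?ts k) (?xi k) s \<omega> = f (grid 0 t (Suc k) i)"
        using ik i1 i2 by (intro simple_process_on_interval[OF si]) auto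
      moreover have "\<bar>f s - f (grid 0 t (Suc k) i)\<bar> \<le> B * (s - grid 0 t (Suc k) i)"
        using i2 s grid_mono[OF t, of 0 i "Suc k"] by (intro B) auto
      moreover have "B * (s - grid 0 t (Suc k) i) \<le> B * (t / real (Suc k))"
        using grid_step[of 0 t "Suc k" i] i1 B(1) by (intro mult_left_mono) auto
      ultimately have "\<bar>simple_process (?n k) (?ts k) (?xi k) s \<omega> - f s\<bar> \<le> B * (t / real (Suc k))"
        by (simp add: abs_minus_commute)
      from power_mono[OF this abs_ge_zero, of 2] show ?thesis by simp
    qed
    have "(\<integral>\<^sup>+s\<in>{0..t}. ennreal ((simple_process (?n k) (?ts k) (?xi k) s \<omega> - f s)\<^sup>2) \<partial>lborel)
        \<le> (\<integral>\<^sup>+s\<in>{0..t}. ennreal ((B * (t / real (Suc k)))\<^sup>2) \<partial>lborel)" for \<omega>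
    proof (rule nn_integral_mono_AE)
      show "AE s in lborel. ennreal ((simple_process (?n k) (?ts k) (?xi k) s \<omega> - f s)\<^sup>2) * indicator {0..t} s
          \<le> ennreal ((B * (t / real (Suc k)))\<^sup>2) * indicator {0..t} s"
        using AE_lborel_singleton[of 0]
      proof eventually_elim
        case (elim s)
        then show ?case using ennreal_leI[OF pt[of s \<omega>]] by (cases "s \<in> {0<..t}") (auto simp: indicator_def)
      qed
    qed
    also have "\<dots> = ennreal ((B * (t / real (Suc k)))\<^sup>2 * t)"
      using t by (subst nn_integral_cmult_indicator) (auto simp: ennreal_mult)
    finally have "(\<integral>\<^sup>+\<omega>. (\<integral>\<^sup>+s\<in>{0..t}.
            ennreal ((simple_process (?n k) (?ts k) (?xi k) s \<omega> - f s)\<^sup>2) \<partial>lborel) \<partial>Q)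
        \<le> (\<integral>\<^sup>+\<omega>. ennreal ((B * (t / real (Suc k)))\<^sup>2 * t) \<partial>Q)"
      by (rule nn_integral_mono)
    then show ?thesis by (simp add: emeasure_space_1)
  qed
  have lim0: "(\<lambda>k. ennreal ((B * (t / real (Suc k)))\<^sup>2 * t)) \<longlonglongrightarrow> 0"
  proof -
    have "(\<lambda>k. (B * (t * inverse (real (Suc k))))\<^sup>2 * t) \<longlonglongrightarrow> (B * (t * 0))\<^sup>2 * t"
      by (intro tendsto_intros LIMSEQ_inverse_real_of_nat)
    from tendsto_ennrealI[OF this] show ?thesis by (simp only: divide_inverse) simp
  qed
  have lim1: "(\<lambda>k. \<integral>\<^sup>+\<omega>. (\<integral>\<^sup>+s\<in>{0..t}.
            ennreal ((simple_process (?n k) (?ts k) (?xi k) s \<omega> - f s)\<^sup>2) \<partial>lborel) \<partial>Q)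
          \<longlonglongrightarrow> 0"
    by (rule tendsto_sandwich[OF always_eventually always_eventually tendsto_const lim0])
      (intro allI zero_le err)+
  have lim2: "(\<lambda>k. \<integral>\<^sup>+\<omega>. ennreal ((simple_integral W (?n k) (?ts k) (?xi k) \<omega> - wiener f f' 0 t \<omega>)\<^sup>2) \<partial>Q)
          \<longlonglongrightarrow> 0"
    by (rule tendsto_sandwich[OF always_eventually always_eventually tendsto_const lim1])
      (intro allI zero_le ito_inequality[OF C1 si])+
  show "\<exists>n ts \<xi>. (\<forall>k. simple_integrand Q F t (n k) (ts k) (\<xi> k)) \<and>
        (\<lambda>k. \<integral>\<^sup>+\<omega>. (\<integral>\<^sup>+s\<in>{0..t}.
            ennreal ((simple_process (n k) (ts k) (\<xi> k) s \<omega> - f s)\<^sup>2) \<partial>lborel) \<partial>Q)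
          \<longlonglongrightarrow> 0 \<and>
        (\<lambda>k. \<integral>\<^sup>+\<omega>. ennreal ((simple_integral W (n k) (ts k) (\<xi> k) \<omega> - wiener f f' 0 t \<omega>)\<^sup>2) \<partial>Q)
          \<longlonglongrightarrow> 0"
    by (intro exI[of _ ?n] exI[of _ ?ts] exI[of _ ?xi] conjI allI si lim1 lim2)
qed

lemma has_ito_integral_unique:
  assumes C1: "C1_on 0 t f f'" and t: "0 \<le> t"
    and X: "has_ito_integral Q F W (\<lambda>s _. f s) t X"
  shows "AE \<omega> in Q. X \<omega> = wiener f f' 0 t \<omega>"
proof -
  let ?J = "wiener f f' 0 t"
  have [measurable]: "X \<in> borel_measurable Q"
    using X by (auto simp: has_ito_integral_def intro: measurable_F_imp_Q)
  have [measurable]: "?J \<in> borel_measurable Q"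
    using wiener_measurable_F[OF C1 order_refl t] by (rule measurable_F_imp_Q)
  obtain n ts \<xi> where si: "\<And>k. simple_integrand Q F t (n k) (ts k) (\<xi> k)"
    and l1: "(\<lambda>k. \<integral>\<^sup>+\<omega>. (\<integral>\<^sup>+s\<in>{0..t}.
            ennreal ((simple_process (n k) (ts k) (\<xi> k) s \<omega> - f s)\<^sup>2) \<partial>lborel) \<partial>Q) \<longlonglongrightarrow> 0"
    and l2: "(\<lambda>k. \<integral>\<^sup>+\<omega>. ennreal ((simple_integral W (n k) (ts k) (\<xi> k) \<omega> - X \<omega>)\<^sup>2) \<partial>Q) \<longlonglongrightarrow> 0"
    using X unfolding has_ito_integral_def by blast
  let ?S = "\<lambda>k. simple_integral W (n k) (ts k) (\<xi> k)"
  have l3: "(\<lambda>k. \<integral>\<^sup>+\<omega>. ennreal ((?S k \<omega> - ?J \<omega>)\<^sup>2) \<partial>Q) \<longlonglongrightarrow> 0"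
    by (rule tendsto_sandwich[OF always_eventually always_eventually tendsto_const l1])
      (intro allI zero_le ito_inequality[OF C1 si])+
  have bound: "(\<integral>\<^sup>+\<omega>. ennreal ((X \<omega> - ?J \<omega>)\<^sup>2) \<partial>Q) \<le>
     2 * (\<integral>\<^sup>+\<omega>. ennreal ((?S k \<omega> - X \<omega>)\<^sup>2) \<partial>Q) + 2 * (\<integral>\<^sup>+\<omega>. ennreal ((?S k \<omega> - ?J \<omega>)\<^sup>2) \<partial>Q)" for k
  proof -
    have [measurable]: "?S k \<in> borel_measurable Q" by (rule simple_integral_measurable[OF si])
    have sq: "(x - y)\<^sup>2 \<le> 2 * (s - x)\<^sup>2 + 2 * (s - y)\<^sup>2" for x y s :: real
      using sum_squares_ge_zero[of "(s - x) + (s - y)" 0] by (simp add: power2_eq_square algebra_simps)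
    have "(\<integral>\<^sup>+\<omega>. ennreal ((X \<omega> - ?J \<omega>)\<^sup>2) \<partial>Q) \<le>
       (\<integral>\<^sup>+\<omega>. 2 * ennreal ((?S k \<omega> - X \<omega>)\<^sup>2) + 2 * ennreal ((?S k \<omega> - ?J \<omega>)\<^sup>2) \<partial>Q)"
    proof (rule nn_integral_mono)
      fix \<omega>
      have "ennreal ((X \<omega> - ?J \<omega>)\<^sup>2) \<le> ennreal (2 * (?S k \<omega> - X \<omega>)\<^sup>2 + 2 * (?S k \<omega> - ?J \<omega>)\<^sup>2)"
        by (rule ennreal_leI[OF sq])
      then show "ennreal ((X \<omega> - ?J \<omega>)\<^sup>2) \<le> 2 * ennreal ((?S k \<omega> - X \<omega>)\<^sup>2) + 2 * ennreal ((?S k \<omega> - ?J \<omega>)\<^sup>2)"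
        by (simp add: ennreal_mult)
    qed
    also have "\<dots> = 2 * (\<integral>\<^sup>+\<omega>. ennreal ((?S k \<omega> - X \<omega>)\<^sup>2) \<partial>Q) + 2 * (\<integral>\<^sup>+\<omega>. ennreal ((?S k \<omega> - ?J \<omega>)\<^sup>2) \<partial>Q)"
      by (subst nn_integral_add) (auto simp: nn_integral_cmult)
    finally show ?thesis .
  qed
  have "(\<lambda>k. 2 * (\<integral>\<^sup>+\<omega>. ennreal ((?S k \<omega> - X \<omega>)\<^sup>2) \<partial>Q) + 2 * (\<integral>\<^sup>+\<omega>. ennreal ((?S k \<omega> - ?J \<omega>)\<^sup>2) \<partial>Q))
      \<longlonglongrightarrow> 2 * 0 + 2 * 0"
    by (intro tendsto_add ennreal_tendsto_cmult l2 l3) auto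
  then have "(\<integral>\<^sup>+\<omega>. ennreal ((X \<omega> - ?J \<omega>)\<^sup>2) \<partial>Q) \<le> 0"
    using bound by (intro LIMSEQ_le_const) auto
  then have "(\<integral>\<^sup>+\<omega>. ennreal ((X \<omega> - ?J \<omega>)\<^sup>2) \<partial>Q) = 0" by simp
  then have "AE \<omega> in Q. ennreal ((X \<omega> - ?J \<omega>)\<^sup>2) = 0"
    by (subst (asm) nn_integral_0_iff_AE) auto
  then show ?thesis by eventually_elim (simp add: ennreal_eq_0_iff)
qed

text \<open>
  Whichever version the choice operator in \<open>ito_integral\<close> picks, it agrees with the path integral.
\<close>

lemma AE_ito_integral_eq_wiener:
  assumes "C1_on 0 t f f'" "0 \<le> t"
  shows "AE \<omega> in Q. ito_integral Q F W (\<lambda>s _. f s) t \<omega> = wiener f f' 0 t \<omega>"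
proof -
  have "has_ito_integral Q F W (\<lambda>s _. f s) t (ito_integral Q F W (\<lambda>s _. f s) t)"
    unfolding ito_integral_def by (rule someI[of _ "wiener f f' 0 t"]) (rule has_ito_integral_wiener[OF assms])
  then show ?thesis by (rule has_ito_integral_unique[OF assms])
qed

end

section \<open>Conditional Laplace transforms\<close>

context augmented_brownian_motion
begin

lemma exp_weighted_increments:
  assumes uv: "0 \<le> u" "u \<le> v" and A: "A \<in> sets (F u)" and k: "k \<le> N"
  shows "integrable Q (\<lambda>\<omega>. indicator A \<omega> * exp (\<Sum>j<k. f (grid u v N j) *
            (W (grid u v N (Suc j)) \<omega> - W (grid u v N j) \<omega>))) \<and>
    expectation (\<lambda>\<omega>. indicator A \<omega> * exp (\<Sum>j<k. f (grid u v N j) *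
            (W (grid u v N (Suc j)) \<omega> - W (grid u v N j) \<omega>))) =
      prob A * exp ((\<Sum>j<k. (f (grid u v N j))\<^sup>2 * ((v - u) / real N)) / 2)"
  using k
proof (induction k)
  case 0
  have "A \<in> sets Q" using A sets_F_subset by auto
  then show ?case by (auto intro!: integrable_real_indicator simp: emeasure_eq_measure)
next
  case (Suc k)
  let ?x = "grid u v N k" and ?y = "grid u v N (Suc k)"
  let ?S = "\<lambda>\<omega>. \<Sum>j<k. f (grid u v N j) * (W (grid u v N (Suc j)) \<omega> - W (grid u v N j) \<omega>)"
  have ge: "u \<le> ?x" using grid_mono[OF uv(2), of 0 k N] by simp
  have xy: "0 \<le> ?x" "?x \<le> ?y" using ge uv grid_mono[OF uv(2), of k "Suc k" N] by auto
  have [measurable]: "A \<in> sets (F ?x)" using A sets_F_mono[OF ge] by auto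
  have [measurable]: "?S \<in> borel_measurable (F ?x)"
    using weighted_increments_measurable_F[OF uv, of k N "\<lambda>_. 0" "\<lambda>j _. f (grid u v N j)"] Suc.prems by simp
  have m: "(\<lambda>\<omega>. indicator A \<omega> * exp (?S \<omega>)) \<in> borel_measurable (F ?x)" by measurable
  have i: "integrable Q (\<lambda>\<omega>. indicator A \<omega> * exp (?S \<omega>))" using Suc by simp
  note st = exp_increment_step[OF xy m i, of "f ?x"]
  have "(\<lambda>\<omega>. indicator A \<omega> * exp (\<Sum>j<Suc k. f (grid u v N j) *
            (W (grid u v N (Suc j)) \<omega> - W (grid u v N j) \<omega>))) =
     (\<lambda>\<omega>. indicator A \<omega> * exp (?S \<omega>) * exp (f ?x * (W ?y \<omega> - W ?x \<omega>)))"
    by (simp add: exp_add mult.assoc)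
  then show ?case using st Suc by (simp add: grid_step exp_add add_divide_distrib)
qed

text \<open>
  The Laplace transform of the path integral, restricted to an event of the past. It is known for
  the approximating sums, and it remains to pass to the limit in the expectations of the
  exponentials. Fatou's lemma gives one inequality. For the other one, the second
  moments of the exponentials are bounded, because squaring doubles \<open>f\<close>, and hence the mass lost by
  truncating at level \<open>K\<close> is at most \<open>B / K\<close>, uniformly in \<open>n\<close>.
\<close>

lemma exp_wiener:
  assumes C1: "C1_on u v f f'" and uv: "0 \<le> u" "u \<le> v" and A: "A \<in> sets (F u)"
  shows "(\<integral>\<^sup>+\<omega>\<in>A. ennreal (exp (wiener f f' u v \<omega>)) \<partial>Q) =
     ennreal (prob A * exp (integral {u..v} (\<lambda>s. (f s)\<^sup>2) / 2))"
proof -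
  have [measurable]: "A \<in> sets Q" using A sets_F_subset by auto
  have [measurable]: "wiener f f' u v \<in> borel_measurable Q"
    using wiener_measurable_F[OF C1 uv] by (rule measurable_F_imp_Q)
  define S where "S = (\<lambda>n \<omega>. \<Sum>j<Suc n. f (grid u v (Suc n) j) *
            (W (grid u v (Suc n) (Suc j)) \<omega> - W (grid u v (Suc n) j) \<omega>))"
  define X where "X = (\<lambda>n \<omega>. indicator A \<omega> * exp (S n \<omega>))"
  define Y where "Y = (\<lambda>\<omega>. indicator A \<omega> * exp (wiener f f' u v \<omega>))"
  define V where "V = (\<lambda>n. \<Sum>j<Suc n. (f (grid u v (Suc n) j))\<^sup>2 * ((v - u) / real (Suc n)))"
  define L where "L = prob A * exp (integral {u..v} (\<lambda>s. (f s)\<^sup>2) / 2)"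
  note C1sq = C1_on_square[OF C1]
  have Vlim: "V \<longlonglongrightarrow> integral {u..v} (\<lambda>s. (f s)\<^sup>2)"
    unfolding V_def by (rule riemann_sums_tendsto_integral[OF C1sq uv(2)])
  have iX: "integrable Q (X n)" and eX: "expectation (X n) = prob A * exp (V n / 2)" for n
    using exp_weighted_increments[OF uv A, of "Suc n" "Suc n" f] unfolding X_def S_def V_def by auto
  have X2: "(\<lambda>\<omega>. (X n \<omega>)\<^sup>2) = (\<lambda>\<omega>. indicator A \<omega> * exp (\<Sum>j<Suc n. (2 * f (grid u v (Suc n) j)) *
            (W (grid u v (Suc n) (Suc j)) \<omega> - W (grid u v (Suc n) j) \<omega>)))" for n
    unfolding X_def S_def mult.assoc[of 2] sum_distrib_left[symmetric]
    by (rule ext) (simp add: power_mult_distrib indicator_def flip: exp_double)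
  have iX2: "integrable Q (\<lambda>\<omega>. (X n \<omega>)\<^sup>2)"
    and eX2: "expectation (\<lambda>\<omega>. (X n \<omega>)\<^sup>2) = prob A * exp (2 * V n)" for n
  proof -
    have "(\<Sum>j<Suc n. (2 * f (grid u v (Suc n) j))\<^sup>2 * ((v - u) / real (Suc n))) = 4 * V n"
      unfolding V_def sum_distrib_left by (rule sum.cong) (simp_all only: power_mult_distrib, simp)
    then have "(\<Sum>j<Suc n. (2 * f (grid u v (Suc n) j))\<^sup>2 * ((v - u) / real (Suc n))) / 2 = 2 * V n"
      by (simp only:)
    then show "integrable Q (\<lambda>\<omega>. (X n \<omega>)\<^sup>2)" "expectation (\<lambda>\<omega>. (X n \<omega>)\<^sup>2) = prob A * exp (2 * V n)"
      unfolding X2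
      using exp_weighted_increments[OF uv A, of "Suc n" "Suc n" "\<lambda>s. 2 * f s"] by auto
  qed
  have "bounded (range V)" using Vlim by (intro convergent_imp_bounded)
  then obtain c where c: "\<And>n. \<bar>V n\<bar> \<le> c" by (auto simp: bounded_iff)
  define B where "B = exp (2 * c)"
  have B: "expectation (\<lambda>\<omega>. (X n \<omega>)\<^sup>2) \<le> B" for n
  proof -
    have "prob A * exp (2 * V n) \<le> 1 * exp (2 * c)"
      using c[of n] by (intro mult_mono) auto
    then show ?thesis by (simp add: eX2 B_def)
  qed
  have lim: "(\<lambda>n. expectation (X n)) \<longlonglongrightarrow> L"
    unfolding eX L_def by (intro tendsto_intros Vlim) simp
  have AEl: "AE \<omega> in Q. (\<lambda>n. X n \<omega>) \<longlonglongrightarrow> Y \<omega>"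
    using AE_riemann_sums_wiener[OF C1 uv]
    by eventually_elim (auto simp: X_def Y_def S_def intro!: tendsto_intros)
  have nnX: "0 \<le> X n \<omega>" and nnY: "0 \<le> Y \<omega>" for n \<omega> by (auto simp: X_def Y_def)
  have [measurable]: "Y \<in> borel_measurable Q" unfolding Y_def by measurable
  have [measurable]: "X n \<in> borel_measurable Q" for n using iX by (rule borel_measurable_integrable)
  have "(\<integral>\<^sup>+\<omega>. ennreal (Y \<omega>) \<partial>Q) = (\<integral>\<^sup>+\<omega>. liminf (\<lambda>n. ennreal (X n \<omega>)) \<partial>Q)"
    using AEl by (intro nn_integral_cong_AE, eventually_elim)
      (rule lim_imp_Liminf[symmetric], simp, rule tendsto_ennrealI)
  also have "\<dots> \<le> liminf (\<lambda>n. \<integral>\<^sup>+\<omega>. ennreal (X n \<omega>) \<partial>Q)"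
    by (intro nn_integral_liminf) auto
  also have "\<dots> = liminf (\<lambda>n. ennreal (expectation (X n)))"
    using nnX by (subst nn_integral_eq_integral[OF iX]) auto
  also have "\<dots> = ennreal L"
    by (rule lim_imp_Liminf[OF _ tendsto_ennrealI[OF lim]]) simp
  finally have le: "(\<integral>\<^sup>+\<omega>. ennreal (Y \<omega>) \<partial>Q) \<le> ennreal L" .
  have iY: "integrable Q Y"
    using le nnY by (intro integrableI_nonneg) (auto intro: le_less_trans)
  have L0: "L \<ge> 0" by (simp add: L_def)
  have YL: "expectation Y \<le> L"
    using le nnY L0 nn_integral_eq_integral[OF iY] by simp
  have trunc: "L - B / K \<le> expectation Y" if K: "K > 0" for K :: real
  proof -
    have lim_min: "(\<lambda>n. expectation (\<lambda>\<omega>. min (X n \<omega>) K)) \<longlonglongrightarrow> expectation (\<lambda>\<omega>. min (Y \<omega>) K)"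
    proof (rule integral_dominated_convergence[where w = "\<lambda>_. K"])
      show "AE \<omega> in Q. (\<lambda>n. min (X n \<omega>) K) \<longlonglongrightarrow> min (Y \<omega>) K"
        using AEl by eventually_elim (intro tendsto_intros)
    qed (use K nnX in auto)
    have iXm: "integrable Q (\<lambda>\<omega>. min (X n \<omega>) K)" for n
      by (rule integrable_const_bound[of _ K]) (use K nnX in auto)
    have iYm: "integrable Q (\<lambda>\<omega>. min (Y \<omega>) K)"
      by (rule integrable_const_bound[of _ K]) (use K nnY in auto)
    have "expectation (X n) - B / K \<le> expectation (\<lambda>\<omega>. min (X n \<omega>) K)" for n
    proof -
      have "expectation (X n) - B / K \<le> expectation (X n) - expectation (\<lambda>\<omega>. (X n \<omega>)\<^sup>2) / K"
        using B[of n] K by (simp add: divide_right_mono)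
      also have "\<dots> = expectation (\<lambda>\<omega>. X n \<omega> - (X n \<omega>)\<^sup>2 / K)"
        using iX iX2 by simp
      also have "\<dots> \<le> expectation (\<lambda>\<omega>. min (X n \<omega>) K)"
      proof (rule integral_mono)
        fix \<omega>
        \<comment> \<open>x - x^2 / K is at most x and, since x^2 - x K + K^2 is nonnegative, at most K.\<close>
        have "0 \<le> X n \<omega> * (X n \<omega>) / K" using K nnX by simp
        moreover have "0 \<le> (X n \<omega> / 2 - K)\<^sup>2 + 3 * (X n \<omega>)\<^sup>2 / 4" by simp
        then have "X n \<omega> * K - (X n \<omega>)\<^sup>2 \<le> K * K"
          by (simp add: power2_eq_square algebra_simps)
        then have "X n \<omega> - (X n \<omega>)\<^sup>2 / K \<le> K"
          using K by (simp add: field_simps)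
        ultimately show "X n \<omega> - (X n \<omega>)\<^sup>2 / K \<le> min (X n \<omega>) K"
          by (simp add: power2_eq_square)
      qed (use iX iX2 iXm in auto)
      finally show ?thesis .
    qed
    then have "L - B / K \<le> expectation (\<lambda>\<omega>. min (Y \<omega>) K)"
      by (intro LIMSEQ_le[OF tendsto_diff[OF lim tendsto_const] lim_min]) auto
    also have "\<dots> \<le> expectation Y" by (intro integral_mono iY iYm) auto
    finally show ?thesis .
  qed
  have "(\<lambda>n. L - B * inverse (real (Suc n))) \<longlonglongrightarrow> L - B * 0"
    by (intro tendsto_intros LIMSEQ_inverse_real_of_nat)
  then have "L \<le> expectation Y"
    using trunc[of "real (Suc _)"] by (intro LIMSEQ_le_const2) (auto simp: divide_inverse)
  with YL have "expectation Y = L" by simp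
  then have "(\<integral>\<^sup>+\<omega>. ennreal (Y \<omega>) \<partial>Q) = ennreal L"
    using nn_integral_eq_integral[OF iY] nnY by simp
  moreover have "ennreal (Y \<omega>) = ennreal (exp (wiener f f' u v \<omega>)) * indicator A \<omega>" for \<omega>
    by (auto simp: Y_def indicator_def)
  ultimately show ?thesis by (simp add: L_def)
qed

text \<open>
  Conditioning is done with nonnegative conditional expectations, where the adapted factor
  \<open>exp G\<close> can be pulled out without knowing that the product is integrable.
\<close>

lemma real_cond_exp_exp_wiener:
  assumes C1: "C1_on u v f f'" and uv: "0 \<le> u" "u \<le> v"
    and G: "G \<in> borel_measurable (F u)"
    and X: "AE \<omega> in Q. X \<omega> = exp (G \<omega> + wiener f f' u v \<omega>)"
  shows "AE \<omega> in Q. real_cond_exp Q (F u) X \<omega> = exp (G \<omega> + integral {u..v} (\<lambda>s. (f s)\<^sup>2) / 2)"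
proof -
  interpret cond: finite_measure_subalgebra Q "F u"
    by unfold_locales (rule subalgebra_F)
  have [measurable]: "wiener f f' u v \<in> borel_measurable Q" "G \<in> borel_measurable Q"
    using wiener_measurable_F[OF C1 uv] G by (auto intro: measurable_F_imp_Q)
  have "AE \<omega> in Q. exp (G \<omega> + wiener f f' u v \<omega>) = X \<omega>" using X by eventually_elim simp
  then have [measurable]: "X \<in> borel_measurable Q" by (rule measurable_Q_AE_cong[rotated]) measurable
  let ?c = "exp (integral {u..v} (\<lambda>s. (f s)\<^sup>2) / 2)"
  have 1: "AE \<omega> in Q. ennreal ?c = nn_cond_exp Q (F u) (\<lambda>\<omega>. ennreal (exp (wiener f f' u v \<omega>))) \<omega>"
  proof (rule cond.nn_cond_exp_charact)
    fix A assume A: "A \<in> sets (F u)"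
    then have "A \<in> sets Q" using sets_F_subset by auto
    then show "(\<integral>\<^sup>+\<omega>\<in>A. ennreal (exp (wiener f f' u v \<omega>)) \<partial>Q) = (\<integral>\<^sup>+\<omega>\<in>A. ennreal ?c \<partial>Q)"
      unfolding exp_wiener[OF C1 uv A]
      by (subst nn_integral_cmult_indicator) (auto simp: emeasure_eq_measure ennreal_mult mult.commute)
  qed simp_all
  have Ge: "(\<lambda>\<omega>. ennreal (exp (G \<omega>))) \<in> borel_measurable (F u)" using G by measurable
  have 2: "AE \<omega> in Q. ennreal (exp (G \<omega>)) * nn_cond_exp Q (F u) (\<lambda>\<omega>. ennreal (exp (wiener f f' u v \<omega>))) \<omega>
     = nn_cond_exp Q (F u) (\<lambda>\<omega>. ennreal (exp (G \<omega>)) * ennreal (exp (wiener f f' u v \<omega>))) \<omega>"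
    by (rule cond.nn_cond_exp_prod[OF Ge]) measurable
  have 3: "AE \<omega> in Q. nn_cond_exp Q (F u) (\<lambda>\<omega>. ennreal (X \<omega>)) \<omega> =
      nn_cond_exp Q (F u) (\<lambda>\<omega>. ennreal (exp (G \<omega>)) * ennreal (exp (wiener f f' u v \<omega>))) \<omega>"
    using X by (intro cond.nn_cond_exp_cong) (auto simp: exp_add ennreal_mult)
  have 4: "AE \<omega> in Q. nn_cond_exp Q (F u) (\<lambda>\<omega>. ennreal (- X \<omega>)) \<omega> = nn_cond_exp Q (F u) (\<lambda>_. 0) \<omega>"
    using X by (intro cond.nn_cond_exp_cong) (auto simp: ennreal_neg)
  have 5: "AE \<omega> in Q. 0 = nn_cond_exp Q (F u) (\<lambda>_. 0) \<omega>"
    by (rule cond.nn_cond_exp_F_meas) simp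
  show ?thesis
    using 1 2 3 4 5
  proof eventually_elim
    case (elim \<omega>)
    have "nn_cond_exp Q (F u) (\<lambda>\<omega>. ennreal (X \<omega>)) \<omega> = ennreal (exp (G \<omega>)) * ennreal ?c"
      using elim(1-3) by simp
    also have "\<dots> = ennreal (exp (G \<omega> + integral {u..v} (\<lambda>s. (f s)\<^sup>2) / 2))"
      by (simp add: exp_add ennreal_mult)
    finally show ?case using elim(4,5) by (simp add: real_cond_exp_def)
  qed
qed

end

section \<open>The bond price\<close>

lemma LBINT_Icc_eq_integral:
  fixes g :: "real \<Rightarrow> real"
  assumes "continuous_on {x..y} g"
  shows "(LBINT s:{x..y}. g s) = integral {x..y} g"
  by (rule set_borel_integral_eq_integral(2)[OF borel_integrable_atLeastAtMost'[OF assms]])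

lemma continuous_eq_on_nonneg:
  fixes f g :: "real \<Rightarrow> real"
  assumes f: "\<And>t. continuous_on {0..t} f" and g: "\<And>t. continuous_on {0..t} g"
    and eq: "\<And>s. s \<in> \<rat> \<Longrightarrow> 0 \<le> s \<Longrightarrow> f s = g s" and s: "0 \<le> s"
  shows "f s = g s"
proof -
  have "closure ({0<..<s + 1} \<inter> \<rat>) = closure {0<..<s + 1}"
    by (rule closure_open_Int_superset) (auto simp: Rats_closure_real)
  then have cl: "closure ({0<..<s + 1} \<inter> \<rat>) = {0..s + 1}" using s by simp
  have "f s - g s = 0"
  proof (rule continuous_constant_on_closure[where f = "\<lambda>s. f s - g s" and S = "{0<..<s + 1} \<inter> \<rat>"])
    show "continuous_on (closure ({0<..<s + 1} \<inter> \<rat>)) (\<lambda>s. f s - g s)"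
      unfolding cl by (intro continuous_intros f g)
    show "s \<in> closure ({0<..<s + 1} \<inter> \<rat>)" unfolding cl using s by simp
  qed (use eq in auto)
  then show ?thesis by simp
qed

lemma bond_m_eq: "bond_m p q b y = p * discount_convolution (p + q) b y"
proof -
  have "bond_m p q b y = integral {0..y} (\<lambda>s. p * (exp (- (p + q) * s) * (1 - exp (- b * (y - s)))))"
    unfolding bond_m_def
    by (subst LBINT_Icc_eq_integral) (auto intro!: continuous_intros simp: mult.assoc)
  then show ?thesis by (simp add: discount_convolution_def)
qed

locale memory_market = augmented_brownian_motion Q F W + memory_parameters p q
  for Q :: "'a measure" and F :: "real \<Rightarrow> 'a measure" and W :: "real \<Rightarrow> 'a \<Rightarrow> real"
    and p q :: real +
  fixes Y :: "real \<Rightarrow> 'a \<Rightarrow> real"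
  assumes Y: "inner_process Q F W p q Y"
begin

text \<open>
  For each time the equality holds almost surely. Continuity of both sides, one by assumption and the
  other by construction, moves the exceptional null set in front of the quantifier over time.
\<close>

lemma AE_Y_eq_inner_path: "AE \<omega> in Q. \<forall>s\<ge>0. Y s \<omega> = inner_path (\<lambda>u. W u \<omega>) s"
proof -
  have pointwise: "AE \<omega> in Q. Y s \<omega> = inner_path (\<lambda>u. W u \<omega>) s" if s: "0 \<le> s" for s
  proof -
    let ?k = "exp (- (p + q) * s)"
    have eq: "(\<lambda>\<tau> (_ :: 'a). p * exp (- (p + q) * (s - \<tau>)) * memory_l p q \<tau>) =
        (\<lambda>\<tau> _. ?k * memory_kernel \<tau>)"
      by (simp only: exp_times_memory_kernel)
    have "\<forall>s\<ge>0. AE \<omega> in Q. Y s \<omega> =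
        ito_integral Q F W (\<lambda>\<tau> _. p * exp (- (p + q) * (s - \<tau>)) * memory_l p q \<tau>) s \<omega>"
      using Y unfolding inner_process_def by (rule conjunct2)
    from this[rule_format, OF s]
    have "AE \<omega> in Q. Y s \<omega> = ito_integral Q F W (\<lambda>\<tau> _. ?k * memory_kernel \<tau>) s \<omega>"
      by (simp only: eq)
    moreover have "AE \<omega> in Q. ito_integral Q F W (\<lambda>\<tau> _. ?k * memory_kernel \<tau>) s \<omega> =
        wiener (\<lambda>\<tau>. ?k * memory_kernel \<tau>) (\<lambda>\<tau>. ?k * memory_kernel' \<tau>) 0 s \<omega>"
      by (rule AE_ito_integral_eq_wiener[OF C1_on_cmult[OF C1_on_memory_kernel] s])
    ultimately show ?thesis
      by eventually_elim (simp add: parts_integral_cmult inner_path_def)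
  qed
  have "AE \<omega> in Q. \<forall>s\<in>\<rat> \<inter> {0..}. Y s \<omega> = inner_path (\<lambda>u. W u \<omega>) s"
    using pointwise by (subst AE_ball_countable) (auto intro: countable_subset[OF _ countable_rat])
  moreover have "AE \<omega> in Q. continuous_on {0..} (\<lambda>t. Y t \<omega>)"
    using Y by (simp add: inner_process_def continuous_adapted_def)
  ultimately show ?thesis
    using AE_W_continuous AE_W_0
  proof eventually_elim
    case (elim \<omega>)
    have "Y s \<omega> = inner_path (\<lambda>u. W u \<omega>) s" if "0 \<le> s" for s
    proof (rule continuous_eq_on_nonneg[OF _ _ _ that])
      show "continuous_on {0..t} (\<lambda>s. Y s \<omega>)" for t
        using elim(2) by (rule continuous_on_subset) auto
      show "continuous_on {0..t} (inner_path (\<lambda>u. W u \<omega>))" for t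
        using elim by (intro continuous_inner_path) (auto intro: continuous_on_subset)
    qed (use elim in auto)
    then show ?case by blast
  qed
qed

text \<open>
  The identity carries a factor \<open>p\<close> on the left, rather than a quotient by \<open>p\<close> on the right, so that \<open>p = 0\<close>
  is covered; both sides then vanish almost surely.
\<close>

lemma AE_inner_from_bond_integral:
  assumes t: "0 \<le> t"
  shows "AE \<omega> in Q. p * (p + 2 * q)\<^sup>2 * exp (q * t) *
     ito_process_integral Q F W (\<lambda>_ _. 1) (\<lambda>s \<omega>'. - Y s \<omega>')
       (\<lambda>s _. exp (q * s) - p / (p + 2 * q) * exp (- q * s)) t \<omega> = Y t \<omega> * memory_denom t"
proof -
  have th: "(\<lambda>s. exp (q * s) - p / (p + 2 * q) * exp (- q * s)) = theta"
    by (simp add: fun_eq_iff theta_def)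
  have "AE \<omega> in Q. ito_integral Q F W (\<lambda>s _. theta s) t \<omega> = wiener theta theta' 0 t \<omega>"
    by (rule AE_ito_integral_eq_wiener[OF C1_on_theta t])
  then show ?thesis
    using AE_Y_eq_inner_path AE_W_continuous AE_W_0
  proof eventually_elim
    case (elim \<omega>)
    let ?w = "\<lambda>u. W u \<omega>"
    have w: "continuous_on {0..t} ?w" using elim(3) by (rule continuous_on_subset) auto
    note cY = continuous_inner_path[OF w elim(4)]
    have "(LBINT s:{0..t}. theta s * - Y s \<omega>) = (LBINT s:{0..t}. - (theta s * inner_path ?w s))"
      using elim(2) by (intro set_lebesgue_integral_cong) auto
    also have "\<dots> = - integral {0..t} (\<lambda>s. theta s * inner_path ?w s)"
      by (subst LBINT_Icc_eq_integral) (auto intro!: continuous_intros cY)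
    finally have "ito_process_integral Q F W (\<lambda>_ _. 1) (\<lambda>s \<omega>'. - Y s \<omega>') (\<lambda>s _. theta s) t \<omega> =
        wiener theta theta' 0 t \<omega> - integral {0..t} (\<lambda>s. theta s * inner_path ?w s)"
      using elim(1) by (simp add: ito_process_integral_def)
    then show ?case
      using inner_path_from_Z[OF w elim(4) t] elim(2) t by (simp add: theta_def)
  qed
qed

lemma AE_integral_short_rate:
  assumes Z: "AE \<omega> in Q. \<forall>t\<ge>0. Z t \<omega> = W t \<omega> - (LBINT s:{0..t}. Y s \<omega>)"
    and r: "short_rate Q F Z a b \<sigma> r0 r" and b: "0 < b" and t: "0 \<le> t" "t \<le> T"
  shows "AE \<omega> in Q. (LBINT s:{t..T}. r s \<omega>) =
    bond_C b t T * r t \<omega> + a / b * (T - t - bond_C b t T)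
    - \<sigma> * discount_convolution (p + q) b (T - t) / b * Y t \<omega>
    + \<sigma> * wiener (loading b T) (loading' b T) t T \<omega>"
proof -
  have "AE \<omega> in Q. continuous_on {0..} (\<lambda>t. r t \<omega>)"
    and "AE \<omega> in Q. \<forall>t\<ge>0. r t \<omega> = r0 + (LBINT s:{0..t}. a - b * r s \<omega>) + \<sigma> * (Z t \<omega> - Z 0 \<omega>)"
    using r by (auto simp: short_rate_def continuous_adapted_def)
  then show ?thesis
    using AE_Y_eq_inner_path AE_W_continuous AE_W_0 Z
  proof eventually_elim
    case (elim \<omega>)
    let ?w = "\<lambda>u. W u \<omega>"
    have w: "continuous_on {0..T} ?w" using elim(4) by (rule continuous_on_subset) auto
    have rc: "continuous_on {0..T} (\<lambda>t. r t \<omega>)" using elim(1) by (rule continuous_on_subset) auto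
    note cY = continuous_inner_path[OF w elim(5)]
    have ZW: "Z x \<omega> = W x \<omega> - integral {0..x} (inner_path ?w)" if x: "x \<in> {0..T}" for x
    proof -
      have "(LBINT s:{0..x}. Y s \<omega>) = (LBINT s:{0..x}. inner_path ?w s)"
        using elim(3) by (intro set_lebesgue_integral_cong) auto
      also have "\<dots> = integral {0..x} (inner_path ?w)"
        using x by (intro LBINT_Icc_eq_integral continuous_on_subset[OF cY]) auto
      finally show ?thesis using elim(6) x by simp
    qed
    have "r x \<omega> = r0 + integral {0..x} (\<lambda>s. a - b * r s \<omega>)
        + \<sigma> * (?w x - integral {0..x} (inner_path ?w))" if x: "x \<in> {0..T}" for x
    proof -
      have "(LBINT s:{0..x}. a - b * r s \<omega>) = integral {0..x} (\<lambda>s. a - b * r s \<omega>)"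
        using x by (intro LBINT_Icc_eq_integral continuous_intros continuous_on_subset[OF rc]) auto
      moreover have "Z 0 \<omega> = 0" using ZW[of 0] x elim(5) by simp
      ultimately show ?thesis using elim(2) ZW[OF x] x by simp
    qed
    from integral_rate_path[OF w elim(5) b rc this t]
    have "integral {t..T} (\<lambda>s. r s \<omega>) = bond_C b t T * r t \<omega> + a / b * (T - t - bond_C b t T)
      - \<sigma> * discount_convolution (p + q) b (T - t) / b * inner_path ?w t
      + \<sigma> * wiener (loading b T) (loading' b T) t T \<omega>" by simp
    moreover have "(LBINT s:{t..T}. r s \<omega>) = integral {t..T} (\<lambda>s. r s \<omega>)"
      using t by (intro LBINT_Icc_eq_integral continuous_on_subset[OF rc]) auto
    ultimately show ?case using elim(3) t by simp
  qed
qed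

lemma variance_loading:
  assumes b: "0 < b" and t: "0 \<le> t" "t \<le> T"
  shows "integral {t..T} (\<lambda>v. (- \<sigma> * loading b T v)\<^sup>2) / 2 =
    \<sigma>\<^sup>2 / (2 * b\<^sup>2) * (LBINT s:{0..T - t}. (bond_m p q b s + exp (- b * s) - 1)\<^sup>2)
    + \<sigma>\<^sup>2 * q * (bond_m p q b (T - t))\<^sup>2 / (b\<^sup>2 * memory_denom t)"
proof -
  have "(LBINT s:{0..T - t}. (bond_m p q b s + exp (- b * s) - 1)\<^sup>2) =
      integral {0..T - t} (\<lambda>s. (bond_m p q b s + exp (- b * s) - 1)\<^sup>2)"
    unfolding bond_m_eq
    by (intro LBINT_Icc_eq_integral continuous_intros continuous_discount_convolution pq_pos)
  moreover have "integral {t..T} (\<lambda>v. (- \<sigma> * loading b T v)\<^sup>2) = \<sigma>\<^sup>2 * integral {t..T} (\<lambda>v. (loading b T v)\<^sup>2)"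
    by (simp add: power_mult_distrib)
  moreover have "b \<noteq> 0" "memory_denom t \<noteq> 0" using b memory_denom_pos[OF t(1)] by auto
  moreover have "s2 * I / 2 = s2 / (2 * b\<^sup>2) * J + s2 * q * m2 / (b\<^sup>2 * d)"
    if "b\<^sup>2 * I = J + 2 * q * m2 / d" "b \<noteq> 0" "d \<noteq> 0" for s2 I J m2 d :: real
  proof -
    have I: "I = (J + 2 * q * m2 / d) / b\<^sup>2" using that by (simp add: field_simps)
    show ?thesis unfolding I using that(2,3) by (simp add: field_simps)
  qed
  ultimately show ?thesis
    using integral_loading_square[OF b t] unfolding bond_m_eq by presburger
qed

end

theorem theorem3p1:
  fixes Q :: "'a measure" and F :: "real \<Rightarrow> 'a measure"
    and W Y Z r :: "real \<Rightarrow> 'a \<Rightarrow> real"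
    and p q a b \<sigma> r0 t T :: real
  assumes "prob_space Q" and "complete_measure Q"
    and "standard_brownian_motion Q W"
    and "F = augmented_filtration Q W"
    and "0 < q" and "- q < p"
    and "inner_process Q F W p q Y"
    and "AE \<omega> in Q. \<forall>t\<ge>0. Z t \<omega> = W t \<omega> - (LBINT s:{0..t}. Y s \<omega>)"
    and "0 < a" and "0 < b" and "0 < \<sigma>" and "0 \<le> r0"
    and "short_rate Q F Z a b \<sigma> r0 r"
    and "0 < T" and "0 \<le> t" and "t \<le> T"
  shows "AE \<omega> in Q. bond_price Q F r t T \<omega> =
           exp (- bond_A p q a b \<sigma> t T - bond_C b t T * r t \<omega> + bond_U Q F W Y p q b \<sigma> t T \<omega>)"
proof -
  interpret prob_space Q by fact
  interpret complete_measure Q by fact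
  interpret memory_market Q F W p q Y by unfold_locales fact+
  note b = \<open>0 < b\<close> and t = \<open>0 \<le> t\<close> \<open>t \<le> T\<close>
  let ?n = "discount_convolution (p + q) b (T - t)"
  define G where "G \<omega> = - bond_C b t T * r t \<omega> - a / b * (T - t - bond_C b t T) + \<sigma> * ?n / b * Y t \<omega>" for \<omega>
  have "r t \<in> borel_measurable (F t)" "Y t \<in> borel_measurable (F t)"
    using assms(7,13) t by (auto simp: short_rate_def inner_process_def continuous_adapted_def)
  then have G: "G \<in> borel_measurable (F t)" unfolding G_def by measurable
  have C1: "C1_on t T (\<lambda>v. - \<sigma> * loading b T v) (\<lambda>v. - \<sigma> * loading' b T v)"
    using t by (intro C1_on_cmult C1_on_subset[OF C1_on_loading[OF b]]) auto
  have "AE \<omega> in Q. exp (- (LBINT s:{t..T}. r s \<omega>)) =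
      exp (G \<omega> + wiener (\<lambda>v. - \<sigma> * loading b T v) (\<lambda>v. - \<sigma> * loading' b T v) t T \<omega>)"
    using AE_integral_short_rate[OF assms(8,13) b t]
    by eventually_elim (simp only: G_def parts_integral_cmult, simp)
  from real_cond_exp_exp_wiener[OF C1 t G this]
  have "AE \<omega> in Q. bond_price Q F r t T \<omega> = exp (G \<omega> + integral {t..T} (\<lambda>v. (- \<sigma> * loading b T v)\<^sup>2) / 2)"
    unfolding bond_price_def .
  then show ?thesis
    using AE_inner_from_bond_integral[OF t(1)]
  proof eventually_elim
    case (elim \<omega>)
    have "bond_U Q F W Y p q b \<sigma> t T \<omega> = \<sigma> * ?n / (b * memory_denom t) * (Y t \<omega> * memory_denom t)"
      unfolding bond_U_def elim(2)[symmetric] bond_m_eq by (simp add: memory_denom_def)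
    also have "\<dots> = \<sigma> * ?n / b * Y t \<omega>" using memory_denom_pos[OF t(1)] by simp
    finally have U: "bond_U Q F W Y p q b \<sigma> t T \<omega> = \<sigma> * ?n / b * Y t \<omega>" .
    show ?case
      unfolding elim(1) U G_def variance_loading[OF b t] bond_A_def memory_denom_def by simp
  qed
qed

end
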